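(* Let $N=N_{M,P,\tau}$ be a generalized Nakamura manifold (as defined in the context) which is not a complex torus. Then $N$ does not admit any astheno-Kähler metric.
   Context: Generalized Nakamura manifolds. Let $M\in SL(n;\mathbb{Z})$ be diagonalizable over $\mathbb{R}$ with positive eigenvalues $e^{\lambda_1},\dots,e^{\lambda_n}$ ($\lambda_i\in\mathbb{R}$; hence $\sum_i\lambda_i=0$), and let $P\in GL(n;\mathbb{R})$ be such that $PMP^{-1}=\mathrm{diag}(e^{\lambda_1},\dots,e^{\lambda_n})$. Let $\rho:\mathbb{C}\to GL(n;\mathbb{C})$, $\rho(w)=\mathrm{diag}(e^{\frac12\lambda_1(w+\bar w)},\dots,e^{\frac12\lambda_n(w+\bar w)})$, and let $\mathbb{C}\ltimes_\rho\mathbb{C}^n$ be the corresponding semidirect product, with coordinates $(w,z_1,\dots,z_n)$. For $\tau\in\mathbb{R}\setminus\{0\}$ put $\Gamma'_\tau=\mathbb{Z}\oplus\sqrt{-1}\,\tau\mathbb{Z}$, $\Gamma''_P=P\mathbb{Z}^n\oplus\sqrt{-1}P\mathbb{Z}^n$ and $\Gamma_{P,\tau}=\Gamma'_\tau\ltimes_\rho\Gamma''_P$, a discrete subgroup. Then $N_{M,P,\tau}=\Gamma_{P,\tau}\backslash(\mathbb{C}\ltimes_\rho\mathbb{C}^n)$ is a compact complex solvmanifold of complex dimension $n+1$. That $N_{M,P,\tau}$ is not a complex torus means that $\lambda_i\neq0$ for some $i$ (so in particular $n\ge2$). Astheno-Kähler metrics. A Hermitian metric $g$ with fundamental form $\omega(U,V)=g(JU,V)$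 on a complex manifold $(X,J)$ of complex dimension $m$ is astheno-Kähler if $\partial\bar\partial\,\omega^{m-2}=0$; here $m=n+1$. *)

theory Defs
  imports "HOL-Analysis.Analysis" "HOL-Algebra.Coset"
begin

section \<open>Differential forms on open subsets of complex coordinate space\<close>

abbreviation cmplx_J :: "complex^'m \<Rightarrow> complex^'m"
  where "cmplx_J v \<equiv> \<i> *s v"

text \<open>For an open set S and a finite-dimensional domain: \<open>f\<close> is of class \<open>C\<^sup>k\<close>, respectively
  smooth, on S.\<close>

primrec Ck_on :: "nat \<Rightarrow> 'a::real_normed_vector set \<Rightarrow> ('a \<Rightarrow> 'b::real_normed_vector) \<Rightarrow> bool" where
  "Ck_on 0 S f \<longleftrightarrow> continuous_on S f"
| "Ck_on (Suc k) S f \<longleftrightarrow>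
     (\<forall>x\<in>S. f differentiable (at x)) \<and> (\<forall>v. Ck_on k S (\<lambda>x. frechet_derivative f (at x) v))"

definition smooth_on :: "'a::real_normed_vector set \<Rightarrow> ('a \<Rightarrow> 'b::real_normed_vector) \<Rightarrow> bool"
  where "smooth_on S f \<longleftrightarrow> (\<forall>k. Ck_on k S f)"

text \<open>A complex-valued k-form is given by its values at a point x on tangent vectors
  \<open>v 0, \<dots>, v (k - 1)\<close>; only these entries of \<open>v\<close> are ever used.\<close>

type_synonym 'm form = "complex^'m \<Rightarrow> (nat \<Rightarrow> complex^'m) \<Rightarrow> complex"

text \<open>Wedge product of a k-form and an l-form, normalised so that
  \<open>(\<alpha> \<and> \<beta>)(u, v) = \<alpha>(u) \<beta>(v) - \<alpha>(v) \<beta>(u)\<close> for 1-forms.\<close>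

definition wedge :: "nat \<Rightarrow> nat \<Rightarrow> 'm::finite form \<Rightarrow> 'm form \<Rightarrow> 'm form" where
  "wedge k l \<alpha> \<beta> x v =
     (\<Sum>\<sigma> | \<sigma> permutes {..<k + l}.
        of_int (sign \<sigma>) * \<alpha> x (\<lambda>i. v (\<sigma> i)) * \<beta> x (\<lambda>i. v (\<sigma> (k + i)))) / (fact k * fact l)"

primrec wedge_power :: "'m::finite form \<Rightarrow> nat \<Rightarrow> 'm form" where
  "wedge_power \<omega> 0 = (\<lambda>x v. 1)"
| "wedge_power \<omega> (Suc k) = wedge 2 (2 * k) \<omega> (wedge_power \<omega> k)"

text \<open>The complex-linear and the antilinear part of the differential of f at x, i.e.
  \<open>\<Sum>\<^sub>j (\<partial>f/\<partial>z\<^sub>j) dz\<^sub>j(v)\<close> and its analogue for the conjugate coordinates.\<close>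

definition fun_del :: "(complex^'m::finite \<Rightarrow> complex) \<Rightarrow> complex^'m \<Rightarrow> complex^'m \<Rightarrow> complex" where
  "fun_del f x v =
     (frechet_derivative f (at x) v - \<i> * frechet_derivative f (at x) (cmplx_J v)) / 2"

definition fun_delbar :: "(complex^'m::finite \<Rightarrow> complex) \<Rightarrow> complex^'m \<Rightarrow> complex^'m \<Rightarrow> complex" where
  "fun_delbar f x v =
     (frechet_derivative f (at x) v + \<i> * frechet_derivative f (at x) (cmplx_J v)) / 2"

text \<open>The Dolbeault operators on k-forms, evaluated on \<open>v 0, \<dots>, v k\<close>: \<open>del\<close> is
  \<open>\<Sum>\<^sub>j dz\<^sub>j \<and> \<partial>\<alpha>/\<partial>z\<^sub>j\<close>, the derivatives acting on the coefficients, and \<open>delbar\<close> is its analogue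
  for the conjugate coordinates.  Their sum is the exterior derivative.\<close>

definition omit :: "nat \<Rightarrow> (nat \<Rightarrow> 'a) \<Rightarrow> nat \<Rightarrow> 'a"
  where "omit i v j = (if j < i then v j else v (Suc j))"

definition del :: "nat \<Rightarrow> 'm::finite form \<Rightarrow> 'm form" where
  "del k \<alpha> x v = (\<Sum>i\<le>k. (-1) ^ i * fun_del (\<lambda>y. \<alpha> y (omit i v)) x (v i))"

definition delbar :: "nat \<Rightarrow> 'm::finite form \<Rightarrow> 'm form" where
  "delbar k \<alpha> x v = (\<Sum>i\<le>k. (-1) ^ i * fun_delbar (\<lambda>y. \<alpha> y (omit i v)) x (v i))"


section \<open>Complex manifolds and Hermitian metrics\<close>

text \<open>A chart is a set of points together with a coordinate map on it.  The atlas also determines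
  the topology of the manifold.\<close>

type_synonym ('p, 'm) chart = "'p set \<times> ('p \<Rightarrow> complex^'m)"

definition chart_image :: "('p, 'm::finite) chart \<Rightarrow> (complex^'m) set"
  where "chart_image c = snd c ` fst c"

definition transition :: "('p, 'm::finite) chart \<Rightarrow> ('p, 'm) chart \<Rightarrow> complex^'m \<Rightarrow> complex^'m"
  where "transition c d = snd d \<circ> inv_into (fst c) (snd c)"

definition complex_atlas :: "'p set \<Rightarrow> ('p, 'm::finite) chart set \<Rightarrow> bool" where
  "complex_atlas X A \<longleftrightarrow>
     (\<Union>c\<in>A. fst c) = X \<and>
     (\<forall>c\<in>A. inj_on (snd c) (fst c) \<and> open (chart_image c)) \<and>
     (\<forall>c\<in>A. \<forall>d\<in>A. open (snd c ` (fst c \<inter> fst d)) \<and>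
        smooth_on (snd c ` (fst c \<inter> fst d)) (transition c d) \<and>
        (\<forall>x \<in> snd c ` (fst c \<inter> fst d). \<forall>v.
           frechet_derivative (transition c d) (at x) (cmplx_J v) =
           cmplx_J (frechet_derivative (transition c d) (at x) v)))"

text \<open>A tensor field of type (0,2) is given by its coordinate expressions in all charts, subject to
  the transformation law.  A Hermitian metric is a Riemannian metric g with g(JU,JV) = g(U,V).\<close>

type_synonym ('p, 'm) metric_tensor =
  "('p, 'm) chart \<Rightarrow> complex^'m \<Rightarrow> complex^'m \<Rightarrow> complex^'m \<Rightarrow> real"

definition hermitian_metric ::
  "('p, 'm::finite) chart set \<Rightarrow> ('p, 'm) metric_tensor \<Rightarrow> bool" where
  "hermitian_metric A g \<longleftrightarrow>
     (\<forall>c\<in>A. \<forall>u v. smooth_on (chart_image c) (\<lambda>x. g c x u v)) \<and>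
     (\<forall>c\<in>A. \<forall>x\<in>chart_image c.
        bilinear (g c x) \<and>
        (\<forall>u v. g c x u v = g c x v u) \<and>
        (\<forall>u. u \<noteq> 0 \<longrightarrow> g c x u u > 0) \<and>
        (\<forall>u v. g c x (cmplx_J u) (cmplx_J v) = g c x u v)) \<and>
     (\<forall>c\<in>A. \<forall>d\<in>A. \<forall>p \<in> fst c \<inter> fst d. \<forall>u v.
        g d (snd d p) (frechet_derivative (transition c d) (at (snd c p)) u)
                      (frechet_derivative (transition c d) (at (snd c p)) v)
        = g c (snd c p) u v)"

definition fundamental_form ::
  "('p, 'm::finite) metric_tensor \<Rightarrow> ('p, 'm) chart \<Rightarrow> 'm form" where
  "fundamental_form g c x v = complex_of_real (g c x (cmplx_J (v 0)) (v 1))"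

definition astheno_kahler ::
  "('p, 'm::finite) chart set \<Rightarrow> ('p, 'm) metric_tensor \<Rightarrow> bool" where
  "astheno_kahler A g \<longleftrightarrow>
     hermitian_metric A g \<and>
     (let k = CARD('m) - 2 in
        \<forall>c\<in>A. \<forall>x\<in>chart_image c. \<forall>v.
          del (2 * k + 1) (delbar (2 * k) (wedge_power (fundamental_form g c) k)) x v = 0)"


section \<open>Generalized Nakamura manifolds\<close>

text \<open>The coordinates \<open>(w, z\<^sub>1, \<dots>, z\<^sub>n)\<close> are indexed by \<open>'n option\<close>, with \<open>w\<close> at index \<open>None\<close>.\<close>

definition wz :: "complex \<Rightarrow> complex^'n::finite \<Rightarrow> complex^('n option)"
  where "wz w z = (\<chi> j. case j of None \<Rightarrow> w | Some i \<Rightarrow> z $ i)"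

definition w_of :: "complex^('n::finite option) \<Rightarrow> complex"
  where "w_of x = x $ None"

definition z_of :: "complex^('n::finite option) \<Rightarrow> complex^'n"
  where "z_of x = (\<chi> i. x $ Some i)"

definition diag_mat :: "('n \<Rightarrow> 'a::zero) \<Rightarrow> 'a^'n^'n::finite"
  where "diag_mat d = (\<chi> i j. if i = j then d i else 0)"

definition nak_rho :: "('n::finite \<Rightarrow> real) \<Rightarrow> complex \<Rightarrow> complex^'n^'n"
  where "nak_rho lam w = diag_mat (\<lambda>i. exp (1/2 * of_real (lam i) * (w + cnj w)))"

definition nak_group :: "('n::finite \<Rightarrow> real) \<Rightarrow> (complex^('n option)) monoid" where
  "nak_group lam =
     \<lparr>carrier = UNIV,
      mult = (\<lambda>x y. wz (w_of x + w_of y) (z_of x + nak_rho lam (w_of x) *v z_of y)),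
      one = 0\<rparr>"

definition nak_base_lattice :: "real \<Rightarrow> complex set"
  where "nak_base_lattice \<tau> = {of_int a + \<i> * of_real \<tau> * of_int b |a b. True}"

definition nak_fibre_lattice :: "real^'n^'n \<Rightarrow> (complex^'n::finite) set" where
  "nak_fibre_lattice P =
     {map_matrix of_real P *v (\<chi> i. of_int (k $ i)) +
        \<i> *s (map_matrix of_real P *v (\<chi> i. of_int (l $ i))) |(k :: int^'n) (l :: int^'n). True}"

definition nak_lattice :: "real^'n^'n \<Rightarrow> real \<Rightarrow> (complex^('n::finite option)) set" where
  "nak_lattice P \<tau> = {wz w z |w z. w \<in> nak_base_lattice \<tau> \<and> z \<in> nak_fibre_lattice P}"

definition nak_proj ::
  "('n::finite \<Rightarrow> real) \<Rightarrow> real^'n^'n \<Rightarrow> real \<Rightarrow> complex^('n option) \<Rightarrow> (complex^('n option)) set"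
  where "nak_proj lam P \<tau> x = nak_lattice P \<tau> #>\<^bsub>nak_group lam\<^esub> x"

definition nak_manifold ::
  "('n::finite \<Rightarrow> real) \<Rightarrow> real^'n^'n \<Rightarrow> real \<Rightarrow> (complex^('n option)) set set"
  where "nak_manifold lam P \<tau> = rcosets\<^bsub>nak_group lam\<^esub> (nak_lattice P \<tau>)"

text \<open>The complex structure on the quotient: the charts are the inverses of the restrictions of the
  projection to open sets on which it is injective.\<close>

definition nak_atlas ::
  "('n::finite \<Rightarrow> real) \<Rightarrow> real^'n^'n \<Rightarrow> real \<Rightarrow> ((complex^('n option)) set, 'n option) chart set" where
  "nak_atlas lam P \<tau> =
     {(nak_proj lam P \<tau> ` V, inv_into V (nak_proj lam P \<tau>)) |V. open V \<and> inj_on (nak_proj lam P \<tau>) V}"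

text \<open>The third condition forces M to be diagonalizable with positive eigenvalues \<open>exp (lam i)\<close>.\<close>

definition nakamura_data ::
  "int^'n^'n \<Rightarrow> real^'n^'n \<Rightarrow> ('n::finite \<Rightarrow> real) \<Rightarrow> real \<Rightarrow> bool" where
  "nakamura_data M P lam \<tau> \<longleftrightarrow>
     det M = 1 \<and> invertible P \<and>
     P ** map_matrix of_int M ** matrix_inv P = diag_mat (\<lambda>i. exp (lam i)) \<and> \<tau> \<noteq> 0"


section \<open>The quotient is a complex manifold\<close>

lemma w_of_wz [simp]: "w_of (wz w z) = w"
  by (simp add: w_of_def wz_def)

lemma z_of_wz [simp]: "z_of (wz w z) = z"
  by (simp add: z_of_def wz_def vec_eq_iff)

lemma wz_eq_iff: "x = y \<longleftrightarrow> w_of x = w_of y \<and> z_of x = z_of y"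
proof -
  have "x $ j = y $ j" if "w_of x = w_of y" "z_of x = z_of y" for j
    using that by (cases j) (auto simp: w_of_def z_of_def vec_eq_iff)
  then show ?thesis unfolding vec_eq_iff [of x y] by (metis vec_eq_iff)
qed

lemma z_of_nth: "z_of x $ i = x $ Some i"
  by (simp add: z_of_def)

lemma diag_mat_mult_vec: "(diag_mat d *v v) $ i = (d i :: 'a::semiring_1) * v $ i"
  by (simp add: diag_mat_def matrix_vector_mult_def if_distrib [of "\<lambda>t. t * _"] cong: if_cong)

lemma nak_rho_nth: "(nak_rho lam w *v v) $ i = exp (of_real (lam i * Re w)) * v $ i"
  by (simp add: nak_rho_def diag_mat_mult_vec complex_add_cnj)

lemma nak_group_simps [simp]:
  "carrier (nak_group lam) = UNIV"
  "x \<otimes>\<^bsub>nak_group lam\<^esub> y = wz (w_of x + w_of y) (z_of x + nak_rho lam (w_of x) *v z_of y)"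
  "\<one>\<^bsub>nak_group lam\<^esub> = 0"
  by (simp_all add: nak_group_def)

lemma w_of_0 [simp]: "w_of 0 = 0" and z_of_0 [simp]: "z_of 0 = 0"
  by (simp_all add: w_of_def z_of_def vec_eq_iff)

lemma nak_group_inv_aux:
  "wz (- w_of x) (- (nak_rho lam (- w_of x) *v z_of x)) \<otimes>\<^bsub>nak_group lam\<^esub> x = \<one>\<^bsub>nak_group lam\<^esub>"
  by (simp add: wz_eq_iff)

lemma group_nak_group: "group (nak_group (lam :: 'n::finite \<Rightarrow> real))"
proof (rule groupI)
  fix x y z :: "complex^('n option)"
  show "x \<otimes>\<^bsub>nak_group lam\<^esub> y \<otimes>\<^bsub>nak_group lam\<^esub> z = x \<otimes>\<^bsub>nak_group lam\<^esub> (y \<otimes>\<^bsub>nak_group lam\<^esub> z)"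
    by (simp add: wz_eq_iff vec_eq_iff nak_rho_nth algebra_simps exp_add)
next
  fix x :: "complex^('n option)"
  show "\<one>\<^bsub>nak_group lam\<^esub> \<otimes>\<^bsub>nak_group lam\<^esub> x = x"
    by (simp add: wz_eq_iff vec_eq_iff nak_rho_nth)
  show "\<exists>y\<in>carrier (nak_group lam). y \<otimes>\<^bsub>nak_group lam\<^esub> x = \<one>\<^bsub>nak_group lam\<^esub>"
    using nak_group_inv_aux [of lam x] by (metis UNIV_I nak_group_simps(1))
qed auto

definition intvec :: "real^'n \<Rightarrow> bool" where "intvec x \<longleftrightarrow> (\<forall>i. x $ i \<in> \<int>)"

lemma nak_fibre_lattice_iff:
  fixes P :: "real^'n^'n::finite"
  shows "z \<in> nak_fibre_lattice P \<longleftrightarrow>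
     (\<exists>k l. intvec k \<and> intvec l \<and> (\<forall>i. z $ i = Complex ((P *v k) $ i) ((P *v l) $ i)))"
proof -
  have *: "(map_matrix of_real P *v (\<chi> i. of_int (k $ i)) +
        \<i> *s (map_matrix of_real P *v (\<chi> i. of_int (l $ i)))) $ i
     = Complex ((P *v (\<chi> i. of_int (k $ i))) $ i) ((P *v (\<chi> i. of_int (l $ i))) $ i)" 
     for k l :: "int^'n" and i
    by (simp add: complex_eq_iff matrix_vector_mult_def)
  have iv: "intvec k \<Longrightarrow> \<exists>k'::int^'n. k = (\<chi> i. of_int (k' $ i))" for k
    by (rule exI [of _ "\<chi> i. \<lfloor>k $ i\<rfloor>"]) (auto simp: intvec_def vec_eq_iff)
  have iv': "intvec (\<chi> i. of_int (k $ i))" for k :: "int^'n"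
    by (simp add: intvec_def)
  show ?thesis
  proof
    assume "z \<in> nak_fibre_lattice P"
    then obtain k l :: "int^'n" where "z = map_matrix of_real P *v (\<chi> i. of_int (k $ i)) +
        \<i> *s (map_matrix of_real P *v (\<chi> i. of_int (l $ i)))"
      unfolding nak_fibre_lattice_def by blast
    then show "\<exists>k l. intvec k \<and> intvec l \<and> (\<forall>i. z $ i = Complex ((P *v k) $ i) ((P *v l) $ i))"
      using * iv' by metis
  next
    assume "\<exists>k l. intvec k \<and> intvec l \<and> (\<forall>i. z $ i = Complex ((P *v k) $ i) ((P *v l) $ i))"
    then obtain k l :: "int^'n" where "\<forall>i. z $ i = Complex ((P *v (\<chi> i. of_int (k $ i))) $ i) ((P *v (\<chi> i. of_int (l $ i))) $ i)"
      using iv by metis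
    then have "z = map_matrix of_real P *v (\<chi> i. of_int (k $ i)) +
        \<i> *s (map_matrix of_real P *v (\<chi> i. of_int (l $ i)))"
      by (simp add: vec_eq_iff del: vector_add_component) (metis *)
    then show "z \<in> nak_fibre_lattice P" unfolding nak_fibre_lattice_def by blast
  qed
qed

lemma intvec_mult: "intvec k \<Longrightarrow> intvec (map_matrix of_int (M::int^'n^'m) *v k)"
  by (auto simp: intvec_def matrix_vector_mult_def)

lemma det_Ints: "(\<And>i j. (A::real^'n^'n) $ i $ j \<in> \<int>) \<Longrightarrow> det A \<in> \<int>"
  by (auto simp: det_def intro!: Ints_sum Ints_mult Ints_prod)

lemma det_of_int: "det (map_matrix of_int (M::int^'n^'n)) = (of_int (det M) :: real)"
  by (simp add: det_def)

lemma intvec_inverse: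
  assumes "det (M::int^'n^'n) = 1" "intvec k"
  obtains k' where "intvec k'" "map_matrix of_int M *v k' = k"
proof -
  let ?M = "map_matrix of_int M :: real^'n^'n"
  have d: "det ?M = 1" using assms by (simp add: det_of_int)
  define k' where "k' = (\<chi> j. det (\<chi> i i'. if i' = j then k $ i else ?M $ i $ i'))"
  have "?M *v k' = k"
    using cramer [of ?M k' k] d by (simp add: k'_def)
  moreover have "intvec k'"
    using assms(2) by (auto simp: intvec_def k'_def intro!: det_Ints)
  ultimately show ?thesis using that by blast
qed

context
  fixes P :: "real^'n^'n" and lam :: "'n::finite \<Rightarrow> real" and \<tau> :: real
begin

private abbreviation (input) "GG \<equiv> nak_group lam"
private abbreviation (input) "L \<equiv> nak_lattice P \<tau>"
private abbreviation (input) "lin \<gamma> y \<equiv> wz (w_of y) (nak_rho lam (w_of \<gamma>) *v z_of y)"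

lemma fibre_add: "x \<in> nak_fibre_lattice P \<Longrightarrow> y \<in> nak_fibre_lattice P \<Longrightarrow> x + y \<in> nak_fibre_lattice P"
proof -
  assume "x \<in> nak_fibre_lattice P" "y \<in> nak_fibre_lattice P"
  then obtain k l k' l' where kl: "intvec k" "intvec l" "\<forall>i. x $ i = Complex ((P *v k) $ i) ((P *v l) $ i)"
    "intvec k'" "intvec l'" "\<forall>i. y $ i = Complex ((P *v k') $ i) ((P *v l') $ i)"
    unfolding nak_fibre_lattice_iff by metis
  then show ?thesis unfolding nak_fibre_lattice_iff
    by (intro exI [of _ "k+k'"] exI [of _ "l+l'"])
       (auto simp: intvec_def matrix_vector_right_distrib complex_eq_iff)
qed

lemma fibre_uminus: "x \<in> nak_fibre_lattice P \<Longrightarrow> - x \<in> nak_fibre_lattice P"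
proof -
  assume "x \<in> nak_fibre_lattice P"
  then obtain k l where kl: "intvec k" "intvec l" "\<forall>i. x $ i = Complex ((P *v k) $ i) ((P *v l) $ i)"
    unfolding nak_fibre_lattice_iff by metis
  have n: "P *v (-k) = - (P *v k)" for k
    using matrix_vector_mult_diff_distrib [of P 0 k] by simp
  show ?thesis unfolding nak_fibre_lattice_iff using kl
    by (intro exI [of _ "-k"] exI [of _ "-l"])
       (auto simp: n intvec_def complex_eq_iff)
qed

lemma fibre_0: "0 \<in> nak_fibre_lattice P"
  unfolding nak_fibre_lattice_iff
  by (intro exI [of _ "0"] exI [of _ "0"]) (auto simp: intvec_def complex_eq_iff)

lemma base_add: "x \<in> nak_base_lattice \<tau> \<Longrightarrow> y \<in> nak_base_lattice \<tau> \<Longrightarrow> x + y \<in> nak_base_lattice \<tau>"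
proof -
  assume "x \<in> nak_base_lattice \<tau>" "y \<in> nak_base_lattice \<tau>"
  then obtain a b a' b' :: int where *: "x = of_int a + \<i> * of_real \<tau> * of_int b"
     "y = of_int a' + \<i> * of_real \<tau> * of_int b'"
    unfolding nak_base_lattice_def by blast
  show ?thesis unfolding nak_base_lattice_def *
    by (rule CollectI, intro exI [of _ "a+a'"] exI [of _ "b+b'"]) (simp add: algebra_simps)
qed

lemma base_uminus: "x \<in> nak_base_lattice \<tau> \<Longrightarrow> - x \<in> nak_base_lattice \<tau>"
proof -
  assume "x \<in> nak_base_lattice \<tau>"
  then obtain a b :: int where *: "x = of_int a + \<i> * of_real \<tau> * of_int b"
    unfolding nak_base_lattice_def by blast
  show ?thesis unfolding nak_base_lattice_def *
    by (rule CollectI, intro exI [of _ "-a"] exI [of _ "-b"]) (simp add: algebra_simps)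
qed

lemma base_0: "0 \<in> nak_base_lattice \<tau>"
  unfolding nak_base_lattice_def
    by (rule CollectI, intro exI [of _ 0]) simp

lemma lattice_iff: "x \<in> L \<longleftrightarrow> w_of x \<in> nak_base_lattice \<tau> \<and> z_of x \<in> nak_fibre_lattice P"
proof
  assume "x \<in> L"
  then show "w_of x \<in> nak_base_lattice \<tau> \<and> z_of x \<in> nak_fibre_lattice P"
    unfolding nak_lattice_def by auto
next
  assume *: "w_of x \<in> nak_base_lattice \<tau> \<and> z_of x \<in> nak_fibre_lattice P"
  have "x = wz (w_of x) (z_of x)" by (simp add: wz_eq_iff)
  with * show "x \<in> L" unfolding nak_lattice_def by blast
qed

lemma norm_w_of: "norm (w_of x) \<le> norm x"
  unfolding w_of_def by (rule Finite_Cartesian_Product.norm_nth_le)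

lemma norm_z_of: "norm (z_of x) \<le> real CARD('n) * norm (x :: complex^('n option))"
proof -
  have "norm (z_of x) \<le> (\<Sum>i\<in>UNIV. norm (z_of x $ i))"
    unfolding norm_vec_def by (rule L2_set_le_sum) simp
  also have "\<dots> \<le> (\<Sum>i\<in>(UNIV :: 'n set). norm x)"
    by (rule sum_mono) (simp add: z_of_nth Finite_Cartesian_Product.norm_nth_le)
  finally show ?thesis by simp
qed

lemma smooth_locally_affine:
  fixes f :: "'a::euclidean_space \<Rightarrow> 'b::real_normed_vector"
  assumes "\<And>x. x \<in> S \<Longrightarrow> \<exists>T A c. open T \<and> x \<in> T \<and> bounded_linear A \<and> (\<forall>y\<in>T. f y = c + A y)"
  shows "Ck_on k S f"
  using assms
proof (induction k arbitrary: f)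
  case 0
  have "isCont f x" if "x \<in> S" for x
  proof -
    obtain T A c where T: "open T" "x \<in> T" "bounded_linear A" "\<forall>y\<in>T. f y = c + A y"
      using 0 \<open>x \<in> S\<close> by blast
    have "continuous_on T (\<lambda>y. c + A y)"
      by (intro continuous_intros linear_continuous_on T)
    then have "continuous_on T f" using T(4) continuous_on_cong [OF refl, of T f] by metis
    then show ?thesis using continuous_on_eq_continuous_at [OF T(1)] T(2) by blast
  qed
  then show ?case by (simp add: continuous_at_imp_continuous_on)
next
  case (Suc k)
  have der: "(f has_derivative A) (at y)" 
    if "open T" "bounded_linear A" "\<forall>y\<in>T. f y = c + A y" "y \<in> T" for T A c y
  proof -
    have "((\<lambda>y. c + A y) has_derivative A) (at y)"
      using that by (auto intro!: derivative_eq_intros bounded_linear_imp_has_derivative)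
    then show ?thesis using that has_derivative_transform_within_open by metis
  qed
  have 1: "f differentiable (at x)" if "x \<in> S" for x
    using Suc.prems [OF that] der unfolding differentiable_def by metis
  have "Ck_on k S (\<lambda>x. frechet_derivative f (at x) v)" for v
  proof (rule Suc.IH)
    fix x assume "x \<in> S"
    then obtain T A c where T: "open T" "x \<in> T" "bounded_linear A" "\<forall>y\<in>T. f y = c + A y"
      using Suc.prems by blast
    have "\<forall>y\<in>T. frechet_derivative f (at y) v = A v + 0"
      using der [OF T(1,3,4)] frechet_derivative_at by force
    then show "\<exists>T B c. open T \<and> x \<in> T \<and> bounded_linear B \<and> (\<forall>y\<in>T. frechet_derivative f (at y) v = c + B y)"
      using T by (intro exI [of _ T] exI [of _ "\<lambda>_. 0"] exI [of _ "A v"]) auto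
  qed
  with 1 show ?case by simp
qed

lemma mult_affine: "\<gamma> \<otimes>\<^bsub>GG\<^esub> y = \<gamma> + lin \<gamma> y"
proof -
  have "w_of (a + b) = w_of a + w_of b" "z_of (a + b) = z_of a + z_of b" for a b :: "complex^('n option)"
    by (simp_all add: w_of_def z_of_def vec_eq_iff)
  then show ?thesis by (simp add: wz_eq_iff)
qed

lemma lin_linear: "linear (lin \<gamma>)"
  by (rule linearI)
    (simp_all add: wz_eq_iff vec_eq_iff w_of_def z_of_def wz_def nak_rho_nth algebra_simps split: option.splits)

lemma lin_bl: "bounded_linear (lin \<gamma>)"
  using lin_linear by (rule linear_conv_bounded_linear [THEN iffD1])

lemma lin_J: "lin \<gamma> (cmplx_J v) = cmplx_J (lin \<gamma> v)"
  by (simp add: vec_eq_iff w_of_def z_of_def wz_def nak_rho_nth algebra_simps split: option.splits)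

private abbreviation (input) "pr \<equiv> nak_proj lam P \<tau>"

context
  fixes M :: "int^'n^'n"
  assumes data: "nakamura_data M P lam \<tau>"
begin

lemma intertwine: "P *v (map_matrix of_int M *v k) = diag_mat (\<lambda>i. exp (lam i)) *v (P *v k)"
proof -
  have "diag_mat (\<lambda>i. exp (lam i)) ** P = P ** map_matrix of_int M ** (matrix_inv P ** P)"
    using data by (simp add: nakamura_data_def matrix_mul_assoc)
  also have "matrix_inv P ** P = mat 1"
    using data someI_ex[of "\<lambda>B. P ** B = mat 1 \<and> B ** P = mat 1"] by (simp add: nakamura_data_def invertible_def matrix_inv_def)
  finally show ?thesis by (simp add: matrix_vector_mul_assoc)
qed

lemma expstep: "intvec k \<Longrightarrow> \<exists>k'. intvec k' \<and> (\<forall>i. (P *v k') $ i = exp (lam i) * (P *v k) $ i)"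
  by (rule exI [of _ "map_matrix of_int M *v k"])
     (simp add: intvec_mult intertwine diag_mat_mult_vec)

lemma expstep': "intvec k \<Longrightarrow> \<exists>k'. intvec k' \<and> (\<forall>i. (P *v k') $ i = exp (- lam i) * (P *v k) $ i)"
proof -
  assume "intvec k"
  then obtain k' where k': "intvec k'" "map_matrix of_int M *v k' = k"
    using data intvec_inverse unfolding nakamura_data_def by blast
  have "(P *v k) $ i = exp (lam i) * (P *v k') $ i" for i
    using intertwine [of k'] k'(2) by (simp add: diag_mat_mult_vec)
  then have "\<forall>i. (P *v k') $ i = exp (- lam i) * (P *v k) $ i"
    by (simp add: mult.assoc [symmetric] exp_minus)
  with k' show ?thesis by blast
qed

lemma expn: "intvec k \<Longrightarrow> \<exists>k'. intvec k' \<and> (\<forall>i. (P *v k') $ i = exp (lam i * real m) * (P *v k) $ i)"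
proof (induction m)
  case 0 then show ?case by auto
next
  case (Suc m)
  then obtain k' where k': "intvec k'" "\<forall>i. (P *v k') $ i = exp (lam i * real m) * (P *v k) $ i" by blast
  obtain k'' where "intvec k''" "\<forall>i. (P *v k'') $ i = exp (lam i) * (P *v k') $ i"
    using expstep [OF k'(1)] by blast
  then show ?case using k' by (intro exI [of _ k'']) (simp add: exp_add algebra_simps)
qed

lemma expn': "intvec k \<Longrightarrow> \<exists>k'. intvec k' \<and> (\<forall>i. (P *v k') $ i = exp (- (lam i * real m)) * (P *v k) $ i)"
proof (induction m)
  case 0 then show ?case by auto
next
  case (Suc m)
  then obtain k' where k': "intvec k'" "\<forall>i. (P *v k') $ i = exp (-(lam i * real m)) * (P *v k) $ i" by blast
  obtain k'' where "intvec k''" "\<forall>i. (P *v k'') $ i = exp (-lam i) * (P *v k') $ i"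
    using expstep' [OF k'(1)] by blast
  moreover have "exp (-lam i) * exp (-(lam i * real m)) = exp (- (lam i * real (Suc m)))" for i
    by (simp add: exp_add [symmetric] algebra_simps)
  ultimately show ?case using k' by (intro exI [of _ k'']) (metis mult.assoc)
qed

lemma expint: "intvec k \<Longrightarrow> \<exists>k'. intvec k' \<and> (\<forall>i. (P *v k') $ i = exp (lam i * of_int a) * (P *v k) $ i)"
  using expn [of k "nat a"] expn' [of k "nat (-a)"] by (cases "a \<ge> 0") auto

lemma rho_lattice:
  assumes "w \<in> nak_base_lattice \<tau>" "z \<in> nak_fibre_lattice P"
  shows "nak_rho lam w *v z \<in> nak_fibre_lattice P"
proof -
  obtain a where a: "Re w = of_int a"
    using assms(1) unfolding nak_base_lattice_def by auto
  obtain k l where kl: "intvec k" "intvec l" "\<forall>i. z $ i = Complex ((P *v k) $ i) ((P *v l) $ i)"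
    using assms(2) unfolding nak_fibre_lattice_iff by blast
  obtain k' l' where "intvec k'" "intvec l'"
    "\<forall>i. (P *v k') $ i = exp (lam i * of_int a) * (P *v k) $ i"
    "\<forall>i. (P *v l') $ i = exp (lam i * of_int a) * (P *v l) $ i"
    using expint kl(1,2) by meson
  then show ?thesis
    unfolding nak_fibre_lattice_iff using kl(3) a
    by (intro exI [of _ k'] exI [of _ l'])
       (auto simp: nak_rho_nth complex_eq_iff Re_exp Im_exp)
qed

lemma subgroup_nak_lattice: "subgroup L GG"
proof (rule group.subgroupI [OF group_nak_group])
  show "L \<noteq> {}" using lattice_iff [of 0] base_0 fibre_0 by auto
  fix x assume x: "x \<in> L"
  have "inv\<^bsub>GG\<^esub> x = wz (- w_of x) (- (nak_rho lam (- w_of x) *v z_of x))"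
    by (rule group.inv_equality [OF group_nak_group nak_group_inv_aux]) auto
  then show "inv\<^bsub>GG\<^esub> x \<in> L"
    using x by (simp add: lattice_iff base_uminus fibre_uminus rho_lattice)
  fix y assume "y \<in> L"
  with x show "x \<otimes>\<^bsub>GG\<^esub> y \<in> L"
    by (simp add: lattice_iff base_add fibre_add rho_lattice)
qed simp

lemma pr_eq_iff: "pr x = pr y \<longleftrightarrow> (\<exists>\<gamma>\<in>L. y = \<gamma> \<otimes>\<^bsub>GG\<^esub> x)"
proof -
  interpret group GG by (rule group_nak_group)
  show ?thesis
  proof
    assume "pr x = pr y"
    then have "y \<in> pr x" using rcos_self [OF _ subgroup_nak_lattice, of y] by (simp add: nak_proj_def)
    then show "\<exists>\<gamma>\<in>L. y = \<gamma> \<otimes>\<^bsub>GG\<^esub> x" unfolding nak_proj_def r_coset_def by blast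
  next
    assume "\<exists>\<gamma>\<in>L. y = \<gamma> \<otimes>\<^bsub>GG\<^esub> x"
    then have "y \<in> L #>\<^bsub>GG\<^esub> x" unfolding r_coset_def by blast
    then show "pr x = pr y" unfolding nak_proj_def
      using repr_independence [OF _ _ subgroup_nak_lattice] by simp
  qed
qed

lemma nak_manifold_eq: "nak_manifold lam P \<tau> = range pr"
  by (auto simp: nak_manifold_def RCOSETS_def nak_proj_def)


lemma base_small: 
  assumes "w \<in> nak_base_lattice \<tau>" "norm w < min 1 \<bar>\<tau>\<bar>"
  shows "w = 0"
proof -
  obtain a b :: int where *: "w = of_int a + \<i> * of_real \<tau> * of_int b"
    using assms unfolding nak_base_lattice_def by blast
  have "\<bar>of_int a :: real\<bar> < 1"
    using abs_Re_le_cmod [of w] assms(2) * by simp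
  then have a: "a = 0" by linarith
  have "\<bar>\<tau> * of_int b\<bar> < \<bar>\<tau>\<bar>"
    using abs_Im_le_cmod [of w] assms(2) * by simp
  then have "\<bar>of_int b :: real\<bar> < 1"
    using mult_less_cancel_left_pos [of "\<bar>\<tau>\<bar>" "\<bar>of_int b\<bar>" 1] data
    by (simp add: abs_mult nakamura_data_def)
  then have "b = 0" by linarith
  with a show ?thesis by (simp add: *)
qed

lemma fibre_small: "\<exists>\<delta>>0. \<forall>z \<in> nak_fibre_lattice P. norm z < \<delta> \<longrightarrow> z = 0"
proof -
  obtain B where B: "B ** P = mat 1"
    using data unfolding nakamura_data_def invertible_def by blast
  obtain K where K: "K > 0" "\<And>x. norm (B *v x) \<le> norm x * K"
    using bounded_linear.pos_bounded [OF matrix_vector_mul_bounded_linear [of B]] by blast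
  have BP: "B *v (P *v k) = k" for k by (simp add: matrix_vector_mul_assoc B)
  define C where "C = real CARD('n) * K"
  have C: "C > 0" using K by (simp add: C_def)
  have zero: "k = 0" if k: "intvec k" and "\<And>i. \<bar>(P *v k) $ i\<bar> < 1 / C" for k
  proof -
    have "norm (P *v k) \<le> (\<Sum>i\<in>UNIV. \<bar>(P *v k) $ i\<bar>)" by (rule norm_le_l1_cart)
    also have "\<dots> < (\<Sum>i\<in>(UNIV::'n set). 1 / C)" by (rule sum_strict_mono) (use that in auto)
    also have "\<dots> = 1 / K" using K by (simp add: C_def)
    finally have "norm (P *v k) * K < 1" using K by (simp add: field_simps)
    then have n: "norm k < 1" using K(2) [of "P *v k"] BP by simp
    have "k $ i = 0" for i
    proof -
      have "\<bar>k $ i\<bar> < 1" using component_le_norm_cart [of k i] n by linarith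
      moreover obtain m :: int where "k $ i = of_int m" using k unfolding intvec_def Ints_def by blast
      ultimately show ?thesis by auto
    qed
    then show ?thesis by (simp add: vec_eq_iff)
  qed
  have "z = 0" if z: "z \<in> nak_fibre_lattice P" "norm z < 1 / C" for z
  proof -
    obtain k l where kl: "intvec k" "intvec l" "\<forall>i. z $ i = Complex ((P *v k) $ i) ((P *v l) $ i)"
      using z unfolding nak_fibre_lattice_iff by metis
    have "\<bar>(P *v k) $ i\<bar> < 1 / C" "\<bar>(P *v l) $ i\<bar> < 1 / C" for i
      using abs_Re_le_cmod [of "z $ i"] abs_Im_le_cmod [of "z $ i"] 
        Finite_Cartesian_Product.norm_nth_le [of z i] z(2) kl(3) by auto
    then have "k = 0" "l = 0" using zero kl by auto
    then show ?thesis using kl(3) unfolding vec_eq_iff by (simp add: complex_eq_iff matrix_vector_mult_def)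
  qed
  then show ?thesis using C by (intro exI [of _ "1/C"]) auto
qed

lemma local_chart: "\<exists>V. open V \<and> x \<in> V \<and> inj_on pr V"
proof -
  obtain \<delta> where \<delta>: "\<delta> > 0" "\<And>z. z \<in> nak_fibre_lattice P \<Longrightarrow> norm z < \<delta> \<Longrightarrow> z = 0"
    using fibre_small by blast
  define r where "r = min (min 1 \<bar>\<tau>\<bar>) (\<delta> / real CARD('n)) / 2"
  have r: "r > 0" "2 * r \<le> min 1 \<bar>\<tau>\<bar>" "real CARD('n) * (2 * r) \<le> \<delta>" 
    using data \<delta>(1) by (auto simp: r_def nakamura_data_def field_simps min_def)
  have "inj_on pr (ball x r)"
  proof (rule inj_onI)
    fix u v assume uv: "u \<in> ball x r" "v \<in> ball x r" "pr u = pr v"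
    then obtain \<gamma> where g: "\<gamma> \<in> L" "v = \<gamma> \<otimes>\<^bsub>GG\<^esub> u" unfolding pr_eq_iff by blast
    have "dist v u < 2 * r" using uv dist_triangle_less_add [of v x r u r] by (simp add: dist_commute)
    then have d: "norm (v - u) < 2 * r" by (simp add: dist_norm)
    have "w_of (v - u) = w_of \<gamma>" using g by (simp add: w_of_def[of "v-u"]) (simp add: w_of_def wz_def)
    then have "norm (w_of \<gamma>) < 2 * r" using norm_w_of [of "v - u"] d by simp
    then have w0: "w_of \<gamma> = 0" using base_small g r(2) lattice_iff by auto
    have "z_of (v - u) = z_of v - z_of u" by (simp add: vec_eq_iff z_of_nth)
    also have "\<dots> = z_of \<gamma>" using arg_cong [OF g(2), of z_of] w0 by (simp add: vec_eq_iff nak_rho_nth)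
    finally have "norm (z_of \<gamma>) \<le> real CARD('n) * norm (v - u)" using norm_z_of [of "v - u"] by simp
    also have "\<dots> < real CARD('n) * (2 * r)" using d by simp
    finally have "z_of \<gamma> = 0" using \<delta>(2) g r(3) lattice_iff by auto
    then show "u = v" using w0 g(2) by (simp add: wz_eq_iff vec_eq_iff nak_rho_nth)
  qed
  then show ?thesis using r by (intro exI [of _ "ball x r"]) auto
qed

lemma atlas_transition:
  assumes V: "open V" "inj_on pr V" and V': "open V'" "inj_on pr V'"
    and x: "x \<in> V" "x' \<in> V'" "\<gamma> \<in> L" "x' = \<gamma> \<otimes>\<^bsub>GG\<^esub> x"
  shows "\<exists>T. open T \<and> x \<in> T \<and> T \<subseteq> V \<and> (\<forall>y\<in>T. \<gamma> \<otimes>\<^bsub>GG\<^esub> y \<in> V' \<and> pr y \<in> pr ` V' \<and>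
     transition (pr ` V, inv_into V pr) (pr ` V', inv_into V' pr) y = \<gamma> + lin \<gamma> y)"
proof -
  let ?T = "V \<inter> (\<lambda>y. \<gamma> + lin \<gamma> y) -` V'"
  have "continuous_on UNIV (\<lambda>y. \<gamma> + lin \<gamma> y)"
    by (intro continuous_intros linear_continuous_on lin_bl)
  then have "open ?T" using V V' by (simp add: open_Int open_vimage)
  moreover have "x \<in> ?T" using x mult_affine by auto
  moreover have "\<gamma> \<otimes>\<^bsub>GG\<^esub> y \<in> V' \<and> pr y \<in> pr ` V' \<and>
     transition (pr ` V, inv_into V pr) (pr ` V', inv_into V' pr) y = \<gamma> + lin \<gamma> y" if y: "y \<in> ?T" for y
  proof -
    have g: "\<gamma> \<otimes>\<^bsub>GG\<^esub> y \<in> V'" using y mult_affine by auto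
    have p: "pr y = pr (\<gamma> \<otimes>\<^bsub>GG\<^esub> y)" using pr_eq_iff x(3) by blast
    have inj: "inj_on (inv_into V pr) (pr ` V)" by (rule inj_on_inv_into) simp
    have "inv_into (pr ` V) (inv_into V pr) y = pr y"
      by (rule inv_into_f_eq [OF inj]) (use y V in auto)
    then have "transition (pr ` V, inv_into V pr) (pr ` V', inv_into V' pr) y = inv_into V' pr (pr (\<gamma> \<otimes>\<^bsub>GG\<^esub> y))"
      by (simp add: transition_def p [symmetric] del: nak_group_simps)
    also have "\<dots> = \<gamma> \<otimes>\<^bsub>GG\<^esub> y" using V' g by (rule_tac inv_into_f_f)
    finally show ?thesis using g p mult_affine by (metis imageI)
  qed
  ultimately show ?thesis by blast
qed

lemma complex_atlas_nak_atlas: "complex_atlas (nak_manifold lam P \<tau>) (nak_atlas lam P \<tau>)"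
proof -
  have cover: "(\<Union>c\<in>nak_atlas lam P \<tau>. fst c) = nak_manifold lam P \<tau>"
  proof (intro equalityI subsetI)
    fix p assume "p \<in> nak_manifold lam P \<tau>"
    then obtain x where "p = pr x" unfolding nak_manifold_eq by blast
    moreover obtain V where "open V" "x \<in> V" "inj_on pr V" using local_chart by blast
    ultimately have "(pr ` V, inv_into V pr) \<in> nak_atlas lam P \<tau>" "p \<in> fst (pr ` V, inv_into V pr)"
      unfolding nak_atlas_def by auto
    then show "p \<in> (\<Union>c\<in>nak_atlas lam P \<tau>. fst c)" by blast
  next
    fix p assume "p \<in> (\<Union>c\<in>nak_atlas lam P \<tau>. fst c)"
    then show "p \<in> nak_manifold lam P \<tau>" unfolding nak_manifold_eq nak_atlas_def by auto
  qed
  have inj: "inj_on (snd c) (fst c) \<and> open (chart_image c)" if "c \<in> nak_atlas lam P \<tau>" for c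
  proof -
    obtain V where V: "open V" "inj_on pr V" "c = (pr ` V, inv_into V pr)"
      using \<open>c \<in> _\<close> unfolding nak_atlas_def by blast
    then show ?thesis by (auto simp: chart_image_def image_image inj_on_inv_into)
  qed
  have trans: "open (snd c ` (fst c \<inter> fst d)) \<and>
        smooth_on (snd c ` (fst c \<inter> fst d)) (transition c d) \<and>
        (\<forall>x \<in> snd c ` (fst c \<inter> fst d). \<forall>v.
           frechet_derivative (transition c d) (at x) (cmplx_J v) =
           cmplx_J (frechet_derivative (transition c d) (at x) v))"
    if cd: "c \<in> nak_atlas lam P \<tau>" "d \<in> nak_atlas lam P \<tau>" for c d
  proof -
    obtain V V' where V: "open V" "inj_on pr V" "c = (pr ` V, inv_into V pr)"
      and V': "open V'" "inj_on pr V'" "d = (pr ` V', inv_into V' pr)"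
      using cd unfolding nak_atlas_def by blast
    let ?S = "snd c ` (fst c \<inter> fst d)"
    have S: "x \<in> ?S \<longleftrightarrow> x \<in> V \<and> pr x \<in> pr ` V'" for x
    proof
      assume "x \<in> ?S"
      then have "\<exists>q \<in> pr ` V \<inter> pr ` V'. x = inv_into V pr q" unfolding V(3) V'(3) by auto
      then obtain y where "y \<in> V" "pr y \<in> pr ` V'" "x = inv_into V pr (pr y)" by blast
      then show "x \<in> V \<and> pr x \<in> pr ` V'" using V by simp
    next
      assume x: "x \<in> V \<and> pr x \<in> pr ` V'"
      then have "x = inv_into V pr (pr x)" using V by simp
      with x show "x \<in> ?S" using V V' by (auto simp del: inv_into_f_f intro!: image_eqI [of _ _ "pr x"])
    qed
    have loc: "\<exists>T \<gamma>. open T \<and> x \<in> T \<and> T \<subseteq> ?S \<and> (\<forall>y\<in>T. transition c d y = \<gamma> + lin \<gamma> y)" if "x \<in> ?S" for x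
    proof -
      obtain x' where x': "x \<in> V" "x' \<in> V'" "pr x = pr x'" using S \<open>x \<in> ?S\<close> by auto
      then obtain \<gamma> where "\<gamma> \<in> L" "x' = \<gamma> \<otimes>\<^bsub>GG\<^esub> x" unfolding pr_eq_iff by blast
      from atlas_transition [OF V(1,2) V'(1,2) x'(1,2) this]
      obtain T where "open T" "x \<in> T" "T \<subseteq> V" "\<forall>y\<in>T. pr y \<in> pr ` V' \<and> transition c d y = \<gamma> + lin \<gamma> y"
        unfolding V(3) [symmetric] V'(3) [symmetric] by blast
      moreover from this have "T \<subseteq> ?S" using S by blast
      ultimately show ?thesis by blast
    qed
    have "open ?S" using loc by (subst open_subopen) metis
    moreover have "smooth_on ?S (transition c d)"
      unfolding smooth_on_def
    proof (intro allI smooth_locally_affine)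
      fix x assume "x \<in> ?S"
      from loc [OF this] obtain T \<gamma> where "open T" "x \<in> T" "\<forall>y\<in>T. transition c d y = \<gamma> + lin \<gamma> y"
        by blast
      then show "\<exists>T A e. open T \<and> x \<in> T \<and> bounded_linear A \<and> (\<forall>y\<in>T. transition c d y = e + A y)"
        by (intro exI [of _ T] exI [of _ "lin \<gamma>"] exI [of _ \<gamma>]) (simp add: lin_bl)
    qed
    moreover have "frechet_derivative (transition c d) (at x) (cmplx_J v) =
           cmplx_J (frechet_derivative (transition c d) (at x) v)" if "x \<in> ?S" for x v
    proof -
      obtain T \<gamma> where T: "open T" "x \<in> T" "\<forall>y\<in>T. transition c d y = \<gamma> + lin \<gamma> y"
        using loc [OF \<open>x \<in> ?S\<close>] by blast
      have "((\<lambda>y. \<gamma> + lin \<gamma> y) has_derivative lin \<gamma>) (at x)"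
        using bounded_linear_imp_has_derivative [OF lin_bl] by (auto intro!: derivative_eq_intros)
      then have "(transition c d has_derivative lin \<gamma>) (at x)"
        by (rule has_derivative_transform_within_open [OF _ T(1,2)]) (use T in auto)
      then have "frechet_derivative (transition c d) (at x) = lin \<gamma>"
        using frechet_derivative_at by metis
      then show ?thesis using lin_J by simp
    qed
    ultimately show ?thesis by blast
  qed
  show ?thesis unfolding complex_atlas_def using cover inj trans by blast
qed

end

end

end

theory Submission
  imports Defs
begin

text \<open>
  Suppose that \<open>\<omega>\<close> is the fundamental form of an astheno-Kaehler metric, put \<open>k = n - 1\<close>, and write
  \<open>\<partial>\<close>, \<open>\<delta>\<close> for \<open>del\<close>, \<open>delbar\<close>, so that \<open>\<partial>\<delta> \<omega>\<^sup>k = 0\<close>.  Some \<open>\<lambda>\<^sub>i\<close> is positive, because the \<open>\<lambda>\<^sub>j\<close> are not all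
  zero and have sum zero.  In the language of currents the obstruction is the invariant form
  \<open>\<phi> = exp (- 2 \<lambda>\<^sub>i Re w) dz\<^sub>i \<and> dz\<^sub>i\<^sup>*\<close>, where the star marks conjugates: \<open>\<partial>\<delta> \<phi>\<close> is \<open>\<lambda>\<^sub>i\<^sup>2\<close> times \<open>dw \<and> dw\<^sup>* \<and> \<phi>\<close>,
  which has constant sign, and integrating it against \<open>\<omega>\<^sup>k\<close> contradicts Stokes' theorem.  The proof below
  is an elementary counterpart of this argument on the universal cover, with averages over periods in place
  of integration on a manifold.

  Lift the metric to the universal cover (\<open>lift_astheno_kahler\<close>) and let A be the coefficient of \<open>\<omega>\<^sup>k\<close> on
  the directions \<open>z\<^sub>j\<close>, \<open>j \<noteq> i\<close>; up to a constant factor it is a principal minor of the Hermitian matrix of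
  the metric.  Three facts about A are incompatible.

  \<^item> A is positive, because principal minors of a positive definite Hermitian matrix are positive.  As
    \<open>\<omega>\<^sup>k\<close> is defined by alternating sums, this is shown for an unnormalised Pfaffian
    (\<open>wedge_power_eq_pfaffian_sum\<close>, \<open>pfaffian_sum_pos\<close>).
  \<^item> The average of A over the periods in the hyperplane \<open>Re w = 0\<close> is an affine function of \<open>Re w\<close>:
    evaluate \<open>\<partial>\<delta> \<omega>\<^sup>k\<close> on the directions w and \<open>z\<^sub>j\<close>, \<open>j \<noteq> i\<close>.  All terms that contain a derivative in
    a periodic direction average to zero, and what remains is the second derivative of the average of A with
    respect to \<open>Re w\<close> (\<open>ddbar_average\<close>).
  \<^item> The lattice element that translates w by 1 rescales the coordinate \<open>z\<^sub>j\<close> by \<open>exp \<lambda>\<^sub>j\<close>.  Since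
    the \<open>\<lambda>\<^sub>j\<close> with \<open>j \<noteq> i\<close> have sum \<open>- \<lambda>\<^sub>i\<close>, this multiplies A by \<open>exp (2 \<lambda>\<^sub>i) > 1\<close>.  On \<open>Re w = 0\<close> the
    function A is periodic, hence bounded below by a positive constant.  So A, and with it the average,
    grows at least exponentially along the positive integers \<open>Re w\<close>.

  An affine function does not grow exponentially.
\<close>


section \<open>Functions of class \<open>C\<^sup>k\<close>\<close>

lemma frechet_derivative_local:
  assumes "open V" "x \<in> V" "\<And>y. y \<in> V \<Longrightarrow> f y = h y"
  shows "frechet_derivative f (at x) = frechet_derivative h (at x)"
proof -
  have "(f has_derivative D) (at x) \<longleftrightarrow> (h has_derivative D) (at x)" for D
    using has_derivative_transform_within_open [OF _ assms(1,2), of f D UNIV h]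
      has_derivative_transform_within_open [OF _ assms(1,2), of h D UNIV f] assms(3) by auto
  then show ?thesis unfolding frechet_derivative_def by simp
qed

lemma Ck_on_cong:
  assumes "open S" "\<And>x. x \<in> S \<Longrightarrow> f x = g x" "Ck_on k S f"
  shows "Ck_on k S g"
  using assms(2,3)
proof (induction k arbitrary: f g)
  case 0
  then show ?case using continuous_on_cong [of S S f g] by simp
next
  case (Suc k)
  have "g differentiable (at x)" if "x \<in> S" for x
  proof -
    have "f differentiable (at x)" using Suc.prems(2) that by simp
    then have "(g has_derivative frechet_derivative f (at x)) (at x)"
      unfolding frechet_derivative_works
      by (rule has_derivative_transform_within_open [OF _ \<open>open S\<close> that Suc.prems(1)])
    then show ?thesis by (rule differentiableI)
  qed
  moreover have "Ck_on k S (\<lambda>x. frechet_derivative g (at x) v)" for v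
  proof (rule Suc.IH)
    show "Ck_on k S (\<lambda>x. frechet_derivative f (at x) v)" using Suc.prems(2) by simp
    fix x assume "x \<in> S"
    then have "f differentiable (at x)" using Suc.prems(2) by simp
    then have "frechet_derivative f (at x) = frechet_derivative g (at x)"
      using \<open>open S\<close> \<open>x \<in> S\<close> Suc.prems(1) by (rule frechet_derivative_transform_within_open)
    then show "frechet_derivative f (at x) v = frechet_derivative g (at x) v" by simp
  qed
  ultimately show ?case by simp
qed

lemma Ck_on_SucD: "Ck_on (Suc k) S f \<Longrightarrow> Ck_on k S f"
proof (induction k arbitrary: f)
  case 0
  then show ?case
    by (simp add: continuous_at_imp_continuous_on differentiable_imp_continuous_within)
next
  case (Suc k)
  then show ?case by simp
qed

text \<open>Used to pass from smoothness in every chart to smoothness on the universal cover.\<close>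

lemma Ck_on_locally:
  assumes "\<And>x. x \<in> S \<Longrightarrow> \<exists>T. open T \<and> x \<in> T \<and> Ck_on k T f"
  shows "Ck_on k S f"
  using assms
proof (induction k arbitrary: f)
  case 0
  have "isCont f x" if "x \<in> S" for x
    using 0 [OF that] continuous_on_eq_continuous_at by auto
  then show ?case by (simp add: continuous_at_imp_continuous_on)
next
  case (Suc k)
  have "f differentiable (at x)" if "x \<in> S" for x
    using Suc.prems [OF that] Ck_on.simps(2) by blast
  moreover have "Ck_on k S (\<lambda>x. frechet_derivative f (at x) v)" for v
  proof (rule Suc.IH)
    fix x assume "x \<in> S"
    then obtain T where "open T" "x \<in> T" "Ck_on (Suc k) T f" using Suc.prems by blast
    then show "\<exists>T. open T \<and> x \<in> T \<and> Ck_on k T (\<lambda>x. frechet_derivative f (at x) v)" by auto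
  qed
  ultimately show ?case by simp
qed

lemma Ck_on_const: "Ck_on k S (\<lambda>x. c)"
proof (induction k arbitrary: c)
  case (Suc k)
  have "frechet_derivative (\<lambda>x. c) (at x) = (\<lambda>_. 0)" for x :: 'a
    by (rule frechet_derivative_const)
  then show ?case using Suc by simp
qed simp

lemma Ck_on_add:
  assumes "open S" "Ck_on k S f" "Ck_on k S g"
  shows "Ck_on k S (\<lambda>x. f x + g x)"
  using assms(2,3)
proof (induction k arbitrary: f g)
  case (Suc k)
  have "frechet_derivative (\<lambda>x. f x + g x) (at x) v
      = frechet_derivative f (at x) v + frechet_derivative g (at x) v" if "x \<in> S" for x v
  proof -
    have "f differentiable (at x)" "g differentiable (at x)"
      using Suc.prems that by auto
    then have "((\<lambda>x. f x + g x) has_derivative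
        (\<lambda>v. frechet_derivative f (at x) v + frechet_derivative g (at x) v)) (at x)"
      unfolding frechet_derivative_works by (rule has_derivative_add)
    from frechet_derivative_at [OF this] show ?thesis by (simp add: fun_eq_iff)
  qed
  moreover have "Ck_on k S (\<lambda>x. frechet_derivative f (at x) v + frechet_derivative g (at x) v)" for v
    using Suc by simp
  ultimately have "Ck_on k S (\<lambda>x. frechet_derivative (\<lambda>x. f x + g x) (at x) v)" for v
    using Ck_on_cong [OF \<open>open S\<close>, of "\<lambda>x. frechet_derivative f (at x) v + frechet_derivative g (at x) v"]
    by simp
  then show ?case using Suc.prems by simp
qed (simp add: continuous_on_add)

lemma Ck_on_mult:
  fixes f g :: "'a::real_normed_vector \<Rightarrow> 'b::real_normed_algebra"
  assumes "open S" "Ck_on k S f" "Ck_on k S g"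
  shows "Ck_on k S (\<lambda>x. f x * g x)"
  using assms(2,3)
proof (induction k arbitrary: f g)
  case (Suc k)
  have *: "frechet_derivative (\<lambda>x. f x * g x) (at x) v
      = f x * frechet_derivative g (at x) v + frechet_derivative f (at x) v * g x" if "x \<in> S" for x v
  proof -
    have "f differentiable (at x)" "g differentiable (at x)"
      using Suc.prems that by auto
    then have "((\<lambda>x. f x * g x) has_derivative
        (\<lambda>v. f x * frechet_derivative g (at x) v + frechet_derivative f (at x) v * g x)) (at x)"
      unfolding frechet_derivative_works by (rule has_derivative_mult)
    from frechet_derivative_at [OF this] show ?thesis by (simp add: fun_eq_iff)
  qed
  have "Ck_on k S (\<lambda>x. f x * frechet_derivative g (at x) v + frechet_derivative f (at x) v * g x)" for v
    using Suc.prems Ck_on_SucD by (intro Ck_on_add [OF \<open>open S\<close>] Suc.IH) auto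
  then have "Ck_on k S (\<lambda>x. frechet_derivative (\<lambda>x. f x * g x) (at x) v)" for v
    by (rule Ck_on_cong [OF \<open>open S\<close>, rotated]) (simp add: *)
  then show ?case using Suc.prems by (simp add: differentiable_mult)
qed (simp add: continuous_on_mult)

lemma Ck_on_sum:
  assumes "open S" "\<And>i. i \<in> I \<Longrightarrow> Ck_on k S (f i)"
  shows "Ck_on k S (\<lambda>x. \<Sum>i\<in>I. f i x)"
  using assms(2) by (induction I rule: infinite_finite_induct) (auto simp: Ck_on_const Ck_on_add [OF \<open>open S\<close>])

lemma Ck_on_prod:
  fixes f :: "'i \<Rightarrow> 'a::real_normed_vector \<Rightarrow> 'b::{real_normed_algebra, comm_ring_1}"
  assumes "open S" "\<And>i. i \<in> I \<Longrightarrow> Ck_on k S (f i)"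
  shows "Ck_on k S (\<lambda>x. \<Prod>i\<in>I. f i x)"
  using assms(2) by (induction I rule: infinite_finite_induct) (auto simp: Ck_on_const Ck_on_mult [OF \<open>open S\<close>])

lemma smooth_on_differentiable: "smooth_on UNIV f \<Longrightarrow> f differentiable (at x)"
  unfolding smooth_on_def using Ck_on.simps(2) by blast

lemma smooth_on_continuous: "smooth_on S f \<Longrightarrow> continuous_on S f"
  unfolding smooth_on_def by (metis Ck_on.simps(1))

abbreviation dirderiv :: "'a::real_normed_vector \<Rightarrow> ('a \<Rightarrow> 'b::real_normed_vector) \<Rightarrow> 'a \<Rightarrow> 'b"
  where "dirderiv v f \<equiv> \<lambda>x. frechet_derivative f (at x) v"

lemma smooth_on_dirderiv: "smooth_on S f \<Longrightarrow> smooth_on S (dirderiv v f)"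
  unfolding smooth_on_def by (metis Ck_on.simps(2))

lemma smooth_on_const_mult: "smooth_on UNIV f \<Longrightarrow> smooth_on UNIV (\<lambda>x. c * f x :: real)"
  unfolding smooth_on_def by (intro allI Ck_on_mult Ck_on_const) auto

lemma smooth_on_add: "smooth_on UNIV f \<Longrightarrow> smooth_on UNIV h \<Longrightarrow> smooth_on UNIV (\<lambda>x. f x + h x)"
  unfolding smooth_on_def by (intro allI Ck_on_add) auto

lemma smooth_on_sum: "(\<And>i. i \<in> I \<Longrightarrow> smooth_on UNIV (f i)) \<Longrightarrow> smooth_on UNIV (\<lambda>x. \<Sum>i\<in>I. f i x)"
  unfolding smooth_on_def by (intro allI Ck_on_sum) auto

lemma dirderiv_linear: "f differentiable (at x) \<Longrightarrow> linear (\<lambda>v. dirderiv v f x)"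
  using linear_frechet_derivative by blast

lemma dirderiv_cmult:
  fixes f :: "'a::real_normed_vector \<Rightarrow> real"
  assumes "f differentiable (at x)"
  shows "dirderiv a (\<lambda>y. c * f y) x = c * dirderiv a f x"
proof -
  have "((\<lambda>y. c * f y) has_derivative (\<lambda>v. c * frechet_derivative f (at x) v)) (at x)"
    using assms unfolding frechet_derivative_works by (rule has_derivative_mult_right)
  from frechet_derivative_at [OF this, symmetric] show ?thesis by simp
qed


section \<open>Averages over periods\<close>

text \<open>The averages are iterated one-dimensional integrals rather than integrals over a parallelepiped: the
  derivative in the direction of integration is then killed by the fundamental theorem of calculus alone,
  and no change of variables is needed.\<close>

definition segment_avg :: "'a::real_normed_vector \<Rightarrow> ('a \<Rightarrow> real) \<Rightarrow> 'a \<Rightarrow> real"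
  where "segment_avg b f y = integral {0..1} (\<lambda>t. f (y + t *\<^sub>R b))"

lemma segment_avg_integrable:
  fixes f :: "'a::real_normed_vector \<Rightarrow> real"
  assumes "continuous_on UNIV f"
  shows "(\<lambda>t. f (y + t *\<^sub>R b)) integrable_on {0..1::real}"
  by (intro integrable_continuous_real) (auto intro!: continuous_on_compose2 [OF assms] continuous_intros)

lemma segment_avg_continuous:
  fixes f :: "'a::euclidean_space \<Rightarrow> real"
  assumes "continuous_on UNIV f"
  shows "continuous_on UNIV (segment_avg b f)"
proof -
  have "continuous_on (UNIV \<times> cbox 0 1) (\<lambda>(y, t::real). f (y + t *\<^sub>R b))"
    unfolding split_def by (rule continuous_on_compose2 [OF assms]) (auto intro!: continuous_intros)
  from integral_continuous_on_param [OF this] show ?thesis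
    unfolding segment_avg_def by simp
qed

text \<open>Differentiation under the integral sign.  The Leibniz rule asks for a derivative that is continuous
  in the operator norm; in finite dimension this follows from continuity of the directional derivatives.\<close>

lemma segment_avg_has_derivative:
  fixes f :: "'a::euclidean_space \<Rightarrow> real"
  assumes f: "\<And>y. f differentiable (at y)" and cont: "\<And>v. continuous_on UNIV (dirderiv v f)"
  shows "(segment_avg b f has_derivative (\<lambda>v. segment_avg b (dirderiv v f) x)) (at x)"
proof -
  define F where "F y = Blinfun (frechet_derivative f (at y))" for y
  have bl: "bounded_linear (frechet_derivative f (at y))" for y
    using f frechet_derivative_works has_derivative_bounded_linear by blast
  have F: "blinfun_apply (F y) = frechet_derivative f (at y)" for y
    unfolding F_def using bl by (rule bounded_linear_Blinfun_apply)
  have "continuous_on UNIV F"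
    by (rule continuous_on_blinfun_componentwise) (simp add: F cont)
  then have c: "continuous_on (UNIV \<times> cbox 0 1) (\<lambda>(y, t::real). F (y + t *\<^sub>R b))"
    unfolding split_def by (rule continuous_on_compose2) (auto intro!: continuous_intros)
  have cf: "continuous_on UNIV f"
    using f by (auto intro!: continuous_at_imp_continuous_on differentiable_imp_continuous_within)
  have "((\<lambda>y. integral (cbox 0 1) (\<lambda>t. f (y + t *\<^sub>R b))) has_derivative
      blinfun_apply (integral (cbox 0 1) (\<lambda>t. F (x + t *\<^sub>R b)))) (at x within UNIV)"
  proof (rule leibniz_rule [OF _ _ c])
    fix y :: 'a and t :: real
    have "((\<lambda>y. y + t *\<^sub>R b) has_derivative (\<lambda>v. v)) (at y)"
      by (auto intro!: derivative_eq_intros)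
    moreover have "(f has_derivative frechet_derivative f (at (y + t *\<^sub>R b))) (at (y + t *\<^sub>R b))"
      using f frechet_derivative_works by blast
    ultimately show "((\<lambda>y. f (y + t *\<^sub>R b)) has_derivative blinfun_apply (F (y + t *\<^sub>R b))) (at y within UNIV)"
      unfolding F using has_derivative_compose by fastforce
  qed (use segment_avg_integrable [OF cf] in auto)
  moreover have "blinfun_apply (integral (cbox 0 1) (\<lambda>t. F (x + t *\<^sub>R b))) v = segment_avg b (dirderiv v f) x" for v
  proof -
    have "(\<lambda>t. F (x + t *\<^sub>R b)) integrable_on cbox (0::real) 1"
      by (rule integrable_continuous) (rule continuous_on_compose2 [OF \<open>continuous_on UNIV F\<close>], auto intro!: continuous_intros)
    then show ?thesis
      by (simp add: segment_avg_def F blinfun_apply_integral flip: F)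
  qed
  then have "blinfun_apply (integral (cbox 0 1) (\<lambda>t. F (x + t *\<^sub>R b))) = (\<lambda>v. segment_avg b (dirderiv v f) x)"
    by (rule ext)
  ultimately show ?thesis
    by (simp add: segment_avg_def [abs_def])
qed

lemma dirderiv_segment_avg:
  fixes f :: "'a::euclidean_space \<Rightarrow> real"
  assumes "smooth_on UNIV f"
  shows "dirderiv v (segment_avg b f) = segment_avg b (dirderiv v f)"
proof
  fix x
  have "(segment_avg b f has_derivative (\<lambda>v. segment_avg b (dirderiv v f) x)) (at x)"
    using smooth_on_differentiable [OF assms] smooth_on_continuous [OF smooth_on_dirderiv [OF assms]]
    by (rule segment_avg_has_derivative)
  from frechet_derivative_at [OF this, symmetric]
  show "dirderiv v (segment_avg b f) x = segment_avg b (dirderiv v f) x" by simp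
qed

lemma Ck_on_segment_avg:
  fixes f :: "'a::euclidean_space \<Rightarrow> real"
  assumes "smooth_on UNIV f"
  shows "Ck_on k UNIV (segment_avg b f)"
  using assms
proof (induction k arbitrary: f)
  case 0
  then show ?case using segment_avg_continuous smooth_on_continuous by auto
next
  case (Suc k)
  have "segment_avg b f differentiable (at x)" for x
    using smooth_on_differentiable [OF Suc.prems] smooth_on_continuous [OF smooth_on_dirderiv [OF Suc.prems]]
    by (rule differentiableI [OF segment_avg_has_derivative])
  moreover have "Ck_on k UNIV (segment_avg b (dirderiv v f))" for v
    by (intro Suc.IH smooth_on_dirderiv Suc.prems)
  ultimately show ?case by (simp add: dirderiv_segment_avg [OF Suc.prems])
qed

lemma smooth_on_segment_avg: "smooth_on UNIV f \<Longrightarrow> smooth_on UNIV (segment_avg b (f :: 'a::euclidean_space \<Rightarrow> real))"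
  unfolding smooth_on_def [of UNIV "segment_avg b f"] using Ck_on_segment_avg by blast

lemma segment_avg_dirderiv_eq_0:
  fixes f :: "'a::euclidean_space \<Rightarrow> real"
  assumes "smooth_on UNIV f" "\<And>y. f (y + b) = f y"
  shows "segment_avg b (dirderiv b f) = (\<lambda>_. 0)"
proof
  fix y
  have "((\<lambda>t. dirderiv b f (y + t *\<^sub>R b)) has_integral f (y + 1 *\<^sub>R b) - f (y + 0 *\<^sub>R b)) {0..1}"
  proof (rule fundamental_theorem_of_calculus)
    fix t :: real
    have D: "(f has_derivative frechet_derivative f (at (y + t *\<^sub>R b))) (at (y + t *\<^sub>R b))"
      using assms(1) smooth_on_differentiable frechet_derivative_works by blast
    have "((\<lambda>t. y + t *\<^sub>R b) has_vector_derivative b) (at t within {0..1})"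
      by (auto intro!: derivative_eq_intros)
    from vector_derivative_diff_chain_within [OF this has_derivative_at_withinI [OF D]]
    show "((\<lambda>t. f (y + t *\<^sub>R b)) has_vector_derivative dirderiv b f (y + t *\<^sub>R b)) (at t within {0..1})"
      by (simp add: o_def)
  qed simp
  then show "segment_avg b (dirderiv b f) y = 0"
    using assms(2) by (simp add: segment_avg_def integral_unique)
qed

lemma segment_avg_lower_bound:
  assumes "continuous_on UNIV f" "\<And>t. c \<le> f (y + t *\<^sub>R b)"
  shows "c \<le> segment_avg b f y"
proof -
  have "integral {0..1::real} (\<lambda>t. c) \<le> segment_avg b f y"
    unfolding segment_avg_def by (rule integral_le) (use assms segment_avg_integrable in auto)
  then show ?thesis by simp
qed

lemma segment_avg_add:
  assumes "continuous_on UNIV f" "continuous_on UNIV g"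
  shows "segment_avg b (\<lambda>x. f x + g x) = (\<lambda>x. segment_avg b f x + segment_avg b g x)"
  unfolding segment_avg_def using integral_add [OF segment_avg_integrable segment_avg_integrable] assms by blast

lemma segment_avg_mult: "segment_avg b (\<lambda>x. c * f x) = (\<lambda>x. c * segment_avg b f x)"
  unfolding segment_avg_def by simp

definition torus_avg :: "'a::real_normed_vector list \<Rightarrow> ('a \<Rightarrow> real) \<Rightarrow> 'a \<Rightarrow> real"
  where "torus_avg bs f = foldr segment_avg bs f"

lemma torus_avg_simps [simp]: "torus_avg [] f = f" "torus_avg (b # bs) f = segment_avg b (torus_avg bs f)"
  by (simp_all add: torus_avg_def)

lemma smooth_on_torus_avg: "smooth_on UNIV f \<Longrightarrow> smooth_on UNIV (torus_avg bs (f :: 'a::euclidean_space \<Rightarrow> real))"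
  by (induction bs) (auto intro: smooth_on_segment_avg)

lemma dirderiv_torus_avg:
  "smooth_on UNIV f \<Longrightarrow> dirderiv v (torus_avg bs f) = torus_avg bs (dirderiv v (f :: 'a::euclidean_space \<Rightarrow> real))"
  by (induction bs) (auto simp: dirderiv_segment_avg smooth_on_torus_avg)

lemma torus_avg_periodic: "(\<And>y. f (y + c) = f y) \<Longrightarrow> torus_avg bs f (y + c) = torus_avg bs f y"
proof (induction bs arbitrary: y)
  case (Cons b bs)
  have "torus_avg bs f (y + c + t *\<^sub>R b) = torus_avg bs f (y + t *\<^sub>R b)" for t
    using Cons.IH [of "y + t *\<^sub>R b", OF Cons.prems] by (simp add: ac_simps)
  then show ?case by (simp add: segment_avg_def)
qed simp

lemma torus_avg_continuous:
  "continuous_on UNIV f \<Longrightarrow> continuous_on UNIV (torus_avg bs (f :: 'a::euclidean_space \<Rightarrow> real))"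
  by (induction bs) (auto intro: segment_avg_continuous)

lemma torus_avg_add:
  fixes f g :: "'a::euclidean_space \<Rightarrow> real"
  assumes "continuous_on UNIV f" "continuous_on UNIV g"
  shows "torus_avg bs (\<lambda>x. f x + g x) = (\<lambda>x. torus_avg bs f x + torus_avg bs g x)"
  using assms by (induction bs) (auto simp: segment_avg_add torus_avg_continuous)

lemma torus_avg_mult: "torus_avg bs (\<lambda>x. c * f x) = (\<lambda>x. c * torus_avg bs f x)"
  by (induction bs) (auto simp: segment_avg_mult)

lemma torus_avg_0: "torus_avg bs (\<lambda>x. 0) = (\<lambda>x. 0)"
  using torus_avg_mult [of bs 0] by simp

lemma torus_avg_sum:
  fixes f :: "'i \<Rightarrow> 'a::euclidean_space \<Rightarrow> real"
  assumes "\<And>i. i \<in> I \<Longrightarrow> continuous_on UNIV (f i)"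
  shows "torus_avg bs (\<lambda>x. \<Sum>i\<in>I. f i x) = (\<lambda>x. \<Sum>i\<in>I. torus_avg bs (f i) x)"
  using assms
  by (induction I rule: infinite_finite_induct) (auto simp: torus_avg_0 torus_avg_add continuous_on_sum)

lemma torus_avg_lower_bound:
  fixes f :: "'a::euclidean_space \<Rightarrow> real"
  assumes "continuous_on UNIV f" "\<And>s. s \<in> span (set bs) \<Longrightarrow> c \<le> f (y + s)"
  shows "c \<le> torus_avg bs f y"
proof -
  have "c \<le> torus_avg bs' f (y + s)" if "s \<in> span (set bs)" "set bs' \<subseteq> set bs" for s bs'
    using that
  proof (induction bs' arbitrary: s)
    case Nil
    then show ?case using assms by simp
  next
    case (Cons b bs')
    have "s + t *\<^sub>R b \<in> span (set bs)" for t
      using Cons.prems by (auto intro!: span_add span_scale intro: span_base)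
    then have "c \<le> torus_avg bs' f (y + s + t *\<^sub>R b)" for t
      using Cons by (simp add: add.assoc)
    then show ?case
      using segment_avg_lower_bound [OF torus_avg_continuous [OF assms(1)]] by simp
  qed
  from this [of 0 bs] show ?thesis by (simp add: span_zero)
qed

text \<open>An exact term has mean zero on a torus.  For a direction b in the list, the averages to the right of b
  commute with the derivative and preserve the period b, so that the average along b is applied to the
  derivative along b of a b-periodic function.  Linearity in the direction extends this to the span.\<close>

lemma torus_avg_dirderiv_eq_0:
  fixes f :: "'a::euclidean_space \<Rightarrow> real"
  assumes f: "smooth_on UNIV f" and per: "\<And>b y. b \<in> set bs \<Longrightarrow> f (y + b) = f y"
    and a: "a \<in> span (set bs)"
  shows "torus_avg bs (dirderiv a f) = (\<lambda>_. 0)"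
proof -
  have base: "torus_avg bs' (dirderiv b f) = (\<lambda>_. 0)" if "b \<in> set bs'" "set bs' \<subseteq> set bs" for b bs'
    using that
  proof (induction bs')
    case (Cons c bs')
    show ?case
    proof (cases "b \<in> set bs'")
      case True
      then show ?thesis using Cons torus_avg_0 [of "[c]"] by simp
    next
      case False
      then have "c = b" using Cons.prems by simp
      moreover have "torus_avg bs' f (y + b) = torus_avg bs' f y" for y
        using per Cons.prems by (intro torus_avg_periodic) auto
      ultimately show ?thesis
        using segment_avg_dirderiv_eq_0 [OF smooth_on_torus_avg [OF f, of bs']] dirderiv_torus_avg [OF f, where v = b and bs = bs', symmetric]
        by simp
    qed
  qed simp
  have lin: "linear (\<lambda>v. dirderiv v f x)" for x
    by (rule dirderiv_linear) (rule smooth_on_differentiable [OF f])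
  have cont: "continuous_on UNIV (dirderiv v f)" for v
    by (intro smooth_on_continuous smooth_on_dirderiv f)
  show ?thesis using a
  proof (induction rule: span_induct_alt)
    case base
    show ?case using lin torus_avg_0 by (simp add: linear_0)
  next
    case (step c x y)
    have "dirderiv (c *\<^sub>R x + y) f = (\<lambda>z. c * dirderiv x f z + dirderiv y f z)"
      by (simp add: linear_add [OF lin] linear_scale [OF lin])
    then show ?case
      using step base [of x bs] by (simp add: torus_avg_add torus_avg_mult cont continuous_on_mult)
  qed
qed


section \<open>Powers of a two-form and Pfaffians\<close>

text \<open>If \<open>B\<close> is alternating, this is \<open>2\<^sup>k k!\<close> times the Pfaffian of the matrix \<open>B (v i) (v j)\<close>.  The
  unnormalised sum over all permutations is the shape in which it arises from iterated wedge products.\<close>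

definition pfaffian_sum :: "nat \<Rightarrow> ('a \<Rightarrow> 'a \<Rightarrow> real) \<Rightarrow> (nat \<Rightarrow> 'a) \<Rightarrow> real" where
  "pfaffian_sum k B v = (\<Sum>\<sigma> | \<sigma> permutes {..<2 * k}.
     of_int (sign \<sigma>) * (\<Prod>i<k. B (v (\<sigma> (2 * i))) (v (\<sigma> (2 * i + 1)))))"

lemma pfaffian_sum_cong:
  assumes "\<And>j. j < 2 * k \<Longrightarrow> v j = w j"
  shows "pfaffian_sum k B v = pfaffian_sum k B w"
proof -
  have "v (\<sigma> j) = w (\<sigma> j)" if "\<sigma> permutes {..<2 * k}" "j < 2 * k" for \<sigma> j
    using assms that permutes_in_image [OF that(1)] by auto
  then show ?thesis unfolding pfaffian_sum_def by (intro sum.cong refl arg_cong2 [where f = "(*)"] prod.cong) auto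
qed

text \<open>Each index occurs in exactly one of the k factors of a summand.\<close>

lemma pfaffian_sum_linear:
  assumes B: "bilinear B" and m: "m < 2 * k"
  shows "linear (\<lambda>x. pfaffian_sum k B (v(m := x)))"
proof -
  let ?F = "\<lambda>x \<sigma> i. B ((v(m := x)) (\<sigma> (2 * i))) ((v(m := x)) (\<sigma> (2 * i + 1)))"
  have "linear (\<lambda>x. of_int (sign \<sigma>) * (\<Prod>i<k. ?F x \<sigma> i))" if \<sigma>: "\<sigma> permutes {..<2 * k}" for \<sigma>
  proof -
    define a where "a = inv_into UNIV \<sigma> m"
    have \<sigma>a: "\<sigma> b = m \<longleftrightarrow> b = a" for b
      unfolding a_def using permutes_inv_eq [OF \<sigma>] by metis
    have a: "a < 2 * k"
      using m permutes_in_image [OF permutes_inv [OF \<sigma>]] by (simp add: a_def)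
    define i where "i = a div 2"
    have i: "i < k" "a = 2 * i \<or> a = 2 * i + 1" using a by (auto simp: i_def)
    have const: "?F x \<sigma> j = ?F 0 \<sigma> j" if "j \<noteq> i" for x j
    proof -
      have "2 * j \<noteq> a" "2 * j + 1 \<noteq> a" using i that by presburger+
      then show ?thesis using \<sigma>a by simp
    qed
    have lin: "linear (\<lambda>x. ?F x \<sigma> i)"
      using i(2)
    proof
      assume "a = 2 * i"
      then have "\<sigma> (2 * i) = m" "\<sigma> (2 * i + 1) \<noteq> m" using \<sigma>a by auto
      then show ?thesis using B by (simp add: bilinear_def)
    next
      assume "a = 2 * i + 1"
      then have "\<sigma> (2 * i) \<noteq> m" "\<sigma> (2 * i + 1) = m" using \<sigma>a by auto
      then show ?thesis using B by (simp add: bilinear_def)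
    qed
    define c where "c = (\<Prod>j\<in>{..<k} - {i}. ?F 0 \<sigma> j)"
    have prod: "(\<Prod>i<k. ?F x \<sigma> i) = ?F x \<sigma> i * c" for x
    proof -
      have "(\<Prod>i<k. ?F x \<sigma> i) = ?F x \<sigma> i * (\<Prod>j\<in>{..<k} - {i}. ?F x \<sigma> j)"
        by (rule prod.remove) (use i(1) in auto)
      also have "(\<Prod>j\<in>{..<k} - {i}. ?F x \<sigma> j) = c"
        unfolding c_def by (rule prod.cong [OF refl], rule const) simp
      finally show ?thesis .
    qed
    have "linear (\<lambda>x. s * (h x * c))" if "linear h" for h :: "'a \<Rightarrow> real" and s
      using that by (simp add: linear_iff algebra_simps)
    from this [OF lin] show ?thesis unfolding prod .
  qed
  then show ?thesis unfolding pfaffian_sum_def by (intro linear_compose_sum) auto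
qed

lemma pfaffian_sum_eq_0_if_repeated:
  assumes m: "m < 2 * k" "m' < 2 * k" "m \<noteq> m'" and v: "v m = v m'"
  shows "pfaffian_sum k B v = 0"
proof -
  let ?\<tau> = "Transposition.transpose m m'"
  let ?T = "\<lambda>\<sigma>. of_int (sign \<sigma>) * (\<Prod>i<k. B (v (\<sigma> (2 * i))) (v (\<sigma> (2 * i + 1))))"
  have \<tau>: "?\<tau> permutes {..<2 * k}" using m by (intro permutes_swap_id) auto
  have v\<tau>: "v (?\<tau> j) = v j" for j
    using v by (simp add: Transposition.transpose_def)
  have "pfaffian_sum k B v = (\<Sum>\<sigma> | \<sigma> permutes {..<2 * k}. ?T (?\<tau> \<circ> \<sigma>))"
    unfolding pfaffian_sum_def by (rule setum_permutations_compose_left [OF \<tau>])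
  also have "\<dots> = (\<Sum>\<sigma> | \<sigma> permutes {..<2 * k}. - ?T \<sigma>)"
  proof (rule sum.cong)
    fix \<sigma> assume "\<sigma> \<in> {\<sigma>. \<sigma> permutes {..<2 * k}}"
    then have "permutation \<sigma>" using permutes_imp_permutation [of "{..<2 * k}"] by simp
    then have "sign (?\<tau> \<circ> \<sigma>) = - sign \<sigma>"
      using m(3) permutation_swap_id by (subst sign_compose) (auto simp: sign_swap_id)
    then show "?T (?\<tau> \<circ> \<sigma>) = - ?T \<sigma>" by (simp add: v\<tau>)
  qed simp
  also have "\<dots> = - pfaffian_sum k B v" by (simp add: pfaffian_sum_def sum_negf)
  finally show ?thesis by simp
qed

text \<open>As for determinants: the added vector only contributes sums with a repeated argument.\<close>

lemma pfaffian_sum_add_span: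
  assumes B: "bilinear B" and m: "m < 2 * k" and y: "y \<in> span (v ` ({..<2 * k} - {m}))"
  shows "pfaffian_sum k B (v(m := x + y)) = pfaffian_sum k B (v(m := x))"
proof -
  have "pfaffian_sum k B (v(m := y)) = 0"
  proof (rule linear_eq_0_on_span [OF pfaffian_sum_linear [OF B m] _ y])
    fix z assume "z \<in> v ` ({..<2 * k} - {m})"
    then obtain j where "j < 2 * k" "j \<noteq> m" "z = v j" by auto
    then show "pfaffian_sum k B (v(m := z)) = 0" using m by (intro pfaffian_sum_eq_0_if_repeated [of m k j]) auto
  qed
  then show ?thesis using linear_add [OF pfaffian_sum_linear [OF B m]] by simp
qed

text \<open>Expansion along a last pair that is orthogonal to the other vectors.  A summand vanishes unless the
  indices \<open>2 k\<close> and \<open>2 k + 1\<close> are paired with each other.  Reordering the pairs or the two members of a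
  pair leaves a summand unchanged, so the \<open>2 (k + 1)\<close> possible positions of the index \<open>2 k\<close> all contribute
  the same amount.\<close>

lemma pfaffian_sum_Suc_orthogonal:
  assumes alt: "\<And>a b. B a b = - B b a"
    and orth: "\<And>j. j < 2 * k \<Longrightarrow> B (v j) (v (2 * k)) = 0"
  shows "pfaffian_sum (Suc k) B v = 2 * real (k + 1) * B (v (2 * k)) (v (2 * k + 1)) * pfaffian_sum k B v"
proof -
  let ?N = "2 * Suc k"
  let ?S = "{\<sigma>. \<sigma> permutes {..<?N}}"
  define T where "T \<sigma> = of_int (sign \<sigma>) * (\<Prod>i<Suc k. B (v (\<sigma> (2 * i))) (v (\<sigma> (2 * i + 1))))" for \<sigma>
  have perm: "permutation \<sigma>" if "\<sigma> \<in> ?S" for \<sigma>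
    using that permutes_imp_permutation [of "{..<?N}" \<sigma>] by simp
  \<comment> \<open>The part of the sum in which position \<open>a\<close> holds the index \<open>2 * k\<close>.\<close>
  define R where "R a = (\<Sum>\<sigma>\<in>?S. if \<sigma> a = 2 * k then T \<sigma> else 0)" for a
  have "pfaffian_sum (Suc k) B v = (\<Sum>\<sigma>\<in>?S. T \<sigma>)" unfolding pfaffian_sum_def T_def by simp
  also have "\<dots> = (\<Sum>\<sigma>\<in>?S. \<Sum>a<?N. if \<sigma> a = 2 * k then T \<sigma> else 0)"
  proof (rule sum.cong)
    fix \<sigma> assume "\<sigma> \<in> ?S"
    then have \<sigma>: "\<sigma> permutes {..<?N}" by simp
    have "\<sigma> a = 2 * k \<longleftrightarrow> a = inv_into UNIV \<sigma> (2 * k)" for a using permutes_inv_eq [OF \<sigma>] by metis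
    moreover have "inv_into UNIV \<sigma> (2 * k) \<in> {..<?N}" using permutes_in_image [OF permutes_inv [OF \<sigma>]] by simp
    ultimately show "T \<sigma> = (\<Sum>a<?N. if \<sigma> a = 2 * k then T \<sigma> else 0)" by simp
  qed simp
  also have "\<dots> = (\<Sum>a<?N. R a)" unfolding R_def by (rule sum.swap)
  also have "\<dots> = (\<Sum>a<?N. R (2 * k))"
  proof (rule sum.cong)
    fix a assume "a \<in> {..<?N}"
    then have a: "a < ?N" by simp
    define i where "i = a div 2"
    have i: "i \<le> k" "a = 2 * i \<or> a = 2 * i + 1" using a by (auto simp: i_def)
    have even: "R (2 * i) = R (2 * k)"
    proof (cases "i = k")
      case False
      then have ik: "i < k" using i by simp
      \<comment> \<open>Exchange the pairs number \<open>i\<close> and \<open>k\<close>; as a product of two transpositions this is even.\<close>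
      let ?q = "Transposition.transpose (2 * i) (2 * k) \<circ> Transposition.transpose (2 * i + 1) (2 * k + 1)"
      have q: "?q permutes {..<?N}"
        using i by (intro permutes_compose permutes_swap_id) auto
      have q2: "?q (2 * j) = 2 * Transposition.transpose i k j" "?q (2 * j + 1) = 2 * Transposition.transpose i k j + 1" for j
        using ik by (auto simp: Transposition.transpose_def)
      have "sign ?q = 1"
        using ik by (subst sign_compose) (auto simp: sign_swap_id permutation_swap_id)
      then have sq: "sign (\<sigma> \<circ> ?q) = sign \<sigma>" if "\<sigma> \<in> ?S" for \<sigma>
        using perm [OF that] perm [of ?q] q by (subst sign_compose) auto
      have "T (\<sigma> \<circ> ?q) = T \<sigma>" if "\<sigma> \<in> ?S" for \<sigma>
      proof -
        have "(\<Prod>j<Suc k. B (v ((\<sigma> \<circ> ?q) (2 * j))) (v ((\<sigma> \<circ> ?q) (2 * j + 1))))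
           = (\<Prod>j<Suc k. B (v (\<sigma> (2 * Transposition.transpose i k j))) (v (\<sigma> (2 * Transposition.transpose i k j + 1))))"
          by (simp only: comp_apply [of \<sigma>] q2)
        also have "\<dots> = (\<Prod>j<Suc k. B (v (\<sigma> (2 * j))) (v (\<sigma> (2 * j + 1))))"
          using prod.permute [OF permutes_swap_id, of i "{..<Suc k}" k
              "\<lambda>j. B (v (\<sigma> (2 * j))) (v (\<sigma> (2 * j + 1)))"] ik
          by (simp add: o_def del: prod.lessThan_Suc)
        finally show ?thesis unfolding T_def sq [OF that] by simp
      qed
      moreover have "(\<sigma> \<circ> ?q) (2 * i) = \<sigma> (2 * k)" for \<sigma> :: "nat \<Rightarrow> nat" using q2(1) [of i] by simp
      ultimately have "(\<Sum>\<sigma>\<in>?S. if (\<sigma> \<circ> ?q) (2 * i) = 2 * k then T (\<sigma> \<circ> ?q) else 0) = R (2 * k)"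
        unfolding R_def by (intro sum.cong refl) (simp only:)
      then show ?thesis
        unfolding R_def by (subst sum_permutations_compose_right [OF q])
    qed simp
    have odd: "R (2 * i + 1) = R (2 * i)"
    proof -
      \<comment> \<open>The odd sign is compensated by \<open>B\<close> being alternating.\<close>
      let ?q = "Transposition.transpose (2 * i) (2 * i + 1)"
      have q: "?q permutes {..<?N}" using i by (intro permutes_swap_id) auto
      have sq: "sign (\<sigma> \<circ> ?q) = - sign \<sigma>" if "\<sigma> \<in> ?S" for \<sigma>
        using perm [OF that] permutation_swap_id by (subst sign_compose) (auto simp: sign_swap_id)
      have "T (\<sigma> \<circ> ?q) = T \<sigma>" if "\<sigma> \<in> ?S" for \<sigma>
      proof -
        have "(\<Prod>j<Suc k. B (v ((\<sigma> \<circ> ?q) (2 * j))) (v ((\<sigma> \<circ> ?q) (2 * j + 1))))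
           = (\<Prod>j<Suc k. (if j = i then -1 else 1) * B (v (\<sigma> (2 * j))) (v (\<sigma> (2 * j + 1))))"
        proof (rule prod.cong [OF refl])
          fix j
          show "B (v ((\<sigma> \<circ> ?q) (2 * j))) (v ((\<sigma> \<circ> ?q) (2 * j + 1)))
            = (if j = i then -1 else 1) * B (v (\<sigma> (2 * j))) (v (\<sigma> (2 * j + 1)))"
          proof (cases "j = i")
            case True
            then show ?thesis using alt [of "v (\<sigma> (2 * i + 1))"] by simp
          next
            case False
            then have "?q (2 * j) = 2 * j" "?q (2 * j + 1) = 2 * j + 1"
              by (auto simp: Transposition.transpose_def)
            then show ?thesis using False by simp
          qed
        qed
        also have "\<dots> = - (\<Prod>j<Suc k. B (v (\<sigma> (2 * j))) (v (\<sigma> (2 * j + 1))))"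
          using i(1) by (simp add: prod.distrib prod.delta del: prod.lessThan_Suc)
        finally show ?thesis unfolding T_def sq [OF that] by simp
      qed
      moreover have "(\<sigma> \<circ> ?q) (2 * i + 1) = \<sigma> (2 * i)" for \<sigma> :: "nat \<Rightarrow> nat" by simp
      ultimately have "(\<Sum>\<sigma>\<in>?S. if (\<sigma> \<circ> ?q) (2 * i + 1) = 2 * k then T (\<sigma> \<circ> ?q) else 0) = R (2 * i)"
        unfolding R_def by (intro sum.cong refl) (simp only:)
      then show ?thesis
        unfolding R_def by (subst sum_permutations_compose_right [OF q])
    qed
    show "R a = R (2 * k)" using i(2) even odd by auto
  qed simp
  also have "\<dots> = 2 * real (k + 1) * R (2 * k)" by simp
  also have "R (2 * k) = B (v (2 * k)) (v (2 * k + 1)) * pfaffian_sum k B v"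
  proof -
    let ?S' = "{\<sigma>. \<sigma> permutes {..<2 * k}}"
    have sub: "?S' \<subseteq> ?S" using permutes_subset [of _ "{..<2 * k}" "{..<?N}"] by auto
    have "R (2 * k) = (\<Sum>\<sigma>\<in>?S'. if \<sigma> (2 * k) = 2 * k then T \<sigma> else 0)"
      unfolding R_def
    proof (rule sum.mono_neutral_right [OF _ sub], goal_cases)
      case 2
      have "T \<sigma> = 0" if \<sigma>: "\<sigma> permutes {..<?N}" "\<sigma> (2 * k) = 2 * k" "\<not> \<sigma> permutes {..<2 * k}" for \<sigma>
      proof -
        let ?c = "\<sigma> (2 * k + 1)"
        have "?c < ?N" using permutes_in_image [OF \<sigma>(1)] by simp
        moreover have "?c \<noteq> 2 * k"
          using \<sigma>(2) permutes_inj [OF \<sigma>(1)] by (metis inj_eq Suc_eq_plus1 n_not_Suc_n)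
        moreover have "?c \<noteq> 2 * k + 1"
        proof
          assume "?c = 2 * k + 1"
          then have "\<sigma> x = x" if "x \<in> {..<?N} - {..<2 * k}" for x
          proof -
            have "x = 2 * k \<or> x = 2 * k + 1" using that by auto
            then show ?thesis using \<sigma>(2) \<open>?c = 2 * k + 1\<close> by auto
          qed
          then have "\<sigma> permutes {..<2 * k}" by (intro permutes_superset [OF \<sigma>(1)])
          with \<sigma>(3) show False by simp
        qed
        ultimately have "?c < 2 * k" by simp
        then have "B (v (\<sigma> (2 * k))) (v ?c) = 0" using orth alt [of "v (2 * k)" "v ?c"] \<sigma>(2) by simp
        then show ?thesis by (simp add: T_def)
      qed
      then show ?case by auto
    qed (simp add: finite_permutations)
    also have "\<dots> = (\<Sum>\<sigma>\<in>?S'. of_int (sign \<sigma>) * (\<Prod>i<k. B (v (\<sigma> (2 * i))) (v (\<sigma> (2 * i + 1))))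
        * B (v (2 * k)) (v (2 * k + 1)))"
    proof (rule sum.cong [OF refl])
      fix \<sigma> assume "\<sigma> \<in> ?S'"
      then have "\<sigma> (2 * k) = 2 * k" "\<sigma> (2 * k + 1) = 2 * k + 1" by (auto simp: permutes_def)
      then show "(if \<sigma> (2 * k) = 2 * k then T \<sigma> else 0) = of_int (sign \<sigma>)
          * (\<Prod>i<k. B (v (\<sigma> (2 * i))) (v (\<sigma> (2 * i + 1)))) * B (v (2 * k)) (v (2 * k + 1))"
        by (simp add: T_def)
    qed
    also have "\<dots> = pfaffian_sum k B v * B (v (2 * k)) (v (2 * k + 1))"
      unfolding pfaffian_sum_def by (rule sum_distrib_right [symmetric])
    finally show ?thesis by (simp only: mult.commute)
  qed
  finally show ?thesis by (simp only: mult.assoc)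
qed

text \<open>Gram-Schmidt for an arbitrary positive definite form in place of the inner product of the type.\<close>

lemma ex_orthogonal_projection:
  fixes G :: "'a::real_vector \<Rightarrow> 'a \<Rightarrow> real"
  assumes G: "bilinear G" and pos: "\<And>u. u \<noteq> 0 \<Longrightarrow> G u u > 0" and sym: "\<And>u v. G u v = G v u"
    and "finite V"
  shows "\<exists>p\<in>span V. \<forall>u\<in>V. G (x - p) u = 0"
  using \<open>finite V\<close>
proof (induction V arbitrary: x rule: finite_induct)
  case empty
  then show ?case by (auto simp: span_zero)
next
  case (insert a V)
  obtain p where p: "p \<in> span V" "\<And>u. u \<in> V \<Longrightarrow> G (x - p) u = 0" using insert.IH by blast
  obtain r where r: "r \<in> span V" "\<And>u. u \<in> V \<Longrightarrow> G (a - r) u = 0" using insert.IH by blast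
  have zero: "G y u = 0" if "u \<in> span V" "\<And>u. u \<in> V \<Longrightarrow> G y u = 0" for y u
    using linear_eq_0_on_span [of "G y" V] that G unfolding bilinear_def by blast
  have sp: "u \<in> span (insert a V)" if "u \<in> span V" for u
    using that span_mono [of V "insert a V"] by auto
  show ?case
  proof (cases "a = r")
    case True
    then have "G (x - p) a = 0" using zero [OF r(1) p(2)] by simp
    then show ?thesis using p sp by blast
  next
    case False
    define c where "c = G (x - p) (a - r) / G (a - r) (a - r)"
    have "G (a - r) (a - r) \<noteq> 0" using pos [of "a - r"] False by auto
    then have c: "G (x - p) (a - r) - c * G (a - r) (a - r) = 0" by (simp add: c_def)
    let ?p = "p + c *\<^sub>R (a - r)"
    have e: "G (x - ?p) u = G (x - p) u - c * G (a - r) u" for u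
    proof -
      have "G (x - ?p) u = G (x - p - c *\<^sub>R (a - r)) u" by (simp add: algebra_simps)
      then show ?thesis by (simp only: bilinear_lsub [OF G] bilinear_lmul [OF G] real_scaleR_def)
    qed
    have V: "G (x - ?p) u = 0" if "u \<in> V" for u using e p r that by simp
    have "G (x - ?p) (a - r) = 0" using e c by simp
    then have "G (x - ?p) a = 0"
      using zero [OF r(1) V] bilinear_rsub [OF G] by simp
    moreover have "?p \<in> span (insert a V)"
      using sp [OF p(1)] sp [OF r(1)] by (intro span_add span_scale span_diff) (simp_all add: span_base)
    ultimately show ?thesis using V by (intro bexI [of _ ?p]) auto
  qed
qed

text \<open>Positivity of the principal minors of a positive definite Hermitian matrix, in real terms.  By
  induction on the number of complex vectors: subtracting from the last one its orthogonal projection to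
  the complex span of the others changes nothing, and then the last pair splits off with the factor
  \<open>G e e > 0\<close>.\<close>

lemma pfaffian_sum_pos:
  fixes J :: "'a::real_vector \<Rightarrow> 'a"
  assumes J: "linear J" "\<And>u. J (J u) = - u"
    and G: "bilinear G" "\<And>u. u \<noteq> 0 \<Longrightarrow> G u u > 0" "\<And>u v. G u v = G v u"
      "\<And>u v. G (J u) (J v) = G u v"
    and indep: "\<And>j. j < k \<Longrightarrow> v (2 * j) \<notin> span (v ` {..<2 * j})"
    and vJ: "\<And>j. j < k \<Longrightarrow> v (2 * j + 1) = J (v (2 * j))"
  shows "0 < pfaffian_sum k (\<lambda>a b. G (J a) b) v"
  using indep vJ
proof (induction k)
  case 0
  then show ?case by (simp add: pfaffian_sum_def)
next
  case (Suc k)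
  let ?B = "\<lambda>a b. G (J a) b"
  have GJ: "G (J a) b = - G a (J b)" for a b
    using G(4) [of a "J b"] J(2) bilinear_rneg [OF G(1)] by simp
  have "linear (\<lambda>a. G (J a) b)" for b
    using linear_compose [OF J(1), of "\<lambda>a. G a b"] G(1) by (simp add: bilinear_def o_def)
  then have B: "bilinear ?B" using G(1) by (simp add: bilinear_def)
  have alt: "?B a b = - ?B b a" for a b using GJ [of a b] G(3) by simp
  let ?V = "v ` {..<2 * k}"
  obtain p where p: "p \<in> span ?V" "\<And>u. u \<in> ?V \<Longrightarrow> G (v (2 * k) - p) u = 0"
    using ex_orthogonal_projection [OF G(1-3), of ?V "v (2 * k)"] by auto
  define e where "e = v (2 * k) - p"
  have "e \<noteq> 0" using p(1) Suc.prems(1) [of k] by (auto simp: e_def)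
  have JV: "J u \<in> span ?V" if u: "u \<in> ?V" for u
  proof -
    obtain j where j: "j < 2 * k" "u = v j" using u by blast
    define i where "i = j div 2"
    have i: "i < k" "j = 2 * i \<or> j = 2 * i + 1" using j by (auto simp: i_def)
    then have "J u = v (2 * i + 1) \<or> J u = - v (2 * i)"
      using Suc.prems(2) [of i] J(2) j(2) by auto
    moreover have "v (2 * i + 1) \<in> span ?V" "v (2 * i) \<in> span ?V"
      using i by (auto intro!: span_base)
    ultimately show ?thesis using span_neg by metis
  qed
  have Jp: "J p \<in> span ?V"
  proof -
    have "J p \<in> J ` span ?V" using p(1) by simp
    also have "\<dots> = span (J ` ?V)" using linear_span_image [OF J(1)] by metis
    also have "\<dots> \<subseteq> span ?V" using JV by (intro span_minimal) (auto simp: subspace_span)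
    finally show ?thesis .
  qed
  have orth: "G e u = 0" if "u \<in> span ?V" for u
    using linear_eq_0_on_span [of "G e" ?V] that G(1) p(2) unfolding bilinear_def e_def by blast
  \<comment> \<open>Replace the last complex vector by its component orthogonal to the others.\<close>
  define v' where "v' = v(2 * k := e, 2 * k + 1 := J e)"
  have "pfaffian_sum (Suc k) ?B v = pfaffian_sum (Suc k) ?B (v(2 * k := e + p))" by (simp add: e_def)
  also have "\<dots> = pfaffian_sum (Suc k) ?B (v(2 * k := e))"
  proof (rule pfaffian_sum_add_span [OF B])
    have "?V \<subseteq> v ` ({..<2 * Suc k} - {2 * k})" by (intro image_mono) auto
    then show "p \<in> span (v ` ({..<2 * Suc k} - {2 * k}))" using p(1) span_mono by blast
  qed simp
  also have "v(2 * k := e) = (v(2 * k := e))(2 * k + 1 := J e + J p)"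
    using Suc.prems(2) [of k] linear_add [OF J(1), of e p] by (auto simp: e_def)
  also have "pfaffian_sum (Suc k) ?B \<dots> = pfaffian_sum (Suc k) ?B v'"
    unfolding v'_def
  proof (rule pfaffian_sum_add_span [OF B])
    have "?V = (v(2 * k := e)) ` {..<2 * k}" by auto
    also have "\<dots> \<subseteq> (v(2 * k := e)) ` ({..<2 * Suc k} - {2 * k + 1})" by (intro image_mono) auto
    finally show "J p \<in> span ((v(2 * k := e)) ` ({..<2 * Suc k} - {2 * k + 1}))"
      using Jp span_mono by blast
  qed simp
  also have "\<dots> = 2 * real (k + 1) * ?B (v' (2 * k)) (v' (2 * k + 1)) * pfaffian_sum k ?B v'"
  proof (rule pfaffian_sum_Suc_orthogonal [OF alt])
    fix j assume "j < 2 * k"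
    then have "G e (J (v j)) = 0" by (intro orth JV) auto
    then show "?B (v' j) (v' (2 * k)) = 0" using \<open>j < 2 * k\<close> G(3) by (simp add: v'_def)
  qed
  also have "pfaffian_sum k ?B v' = pfaffian_sum k ?B v" by (rule pfaffian_sum_cong) (simp add: v'_def)
  also have "?B (v' (2 * k)) (v' (2 * k + 1)) = G e e" using G(4) by (simp add: v'_def)
  finally have "pfaffian_sum (Suc k) ?B v = 2 * real (k + 1) * G e e * pfaffian_sum k ?B v" .
  moreover have "0 < pfaffian_sum k ?B v" using Suc by auto
  ultimately show ?case using G(2) [OF \<open>e \<noteq> 0\<close>] by simp
qed

text \<open>In the recursive definition of the power, the inner permutation can be absorbed into the outer one
  after shifting it past the first two indices.  Each summand is then counted \<open>(2 k)!\<close> times, which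
  cancels the normalisation of the wedge product.\<close>

lemma wedge_power_eq_pfaffian_sum:
  fixes \<omega> :: "'m::finite form"
  assumes "\<And>v. \<omega> x v = of_real (B (v 0) (v 1))"
  shows "wedge_power \<omega> k x v = of_real (pfaffian_sum k B v / 2 ^ k)"
proof (induction k arbitrary: v)
  case 0
  then show ?case by (simp add: pfaffian_sum_def)
next
  case (Suc k)
  let ?N = "{..<2 + 2 * k}"
  define T where "T \<sigma> = of_int (sign \<sigma>) * (\<Prod>i<Suc k. B (v (\<sigma> (2 * i))) (v (\<sigma> (2 * i + 1))))" for \<sigma>
  define up where "up = map_permutation {..<2 * k} (\<lambda>i. i + 2)"
  have inj: "inj_on (\<lambda>i. i + 2) {..<2 * k}" by (auto intro: inj_onI)
  have sum_T: "pfaffian_sum (Suc k) B v = (\<Sum>\<sigma> | \<sigma> permutes ?N. T \<sigma>)" by (simp add: pfaffian_sum_def T_def)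
  have up: "up \<pi> permutes ?N" "sign (up \<pi>) = sign \<pi>" "up \<pi> 0 = 0" "up \<pi> 1 = 1"
    "\<And>i. i < 2 * k \<Longrightarrow> up \<pi> (2 + i) = 2 + \<pi> i" if \<pi>: "\<pi> permutes {..<2 * k}" for \<pi>
  proof -
    have *: "up \<pi> permutes (\<lambda>i. i + 2) ` {..<2 * k}"
      unfolding up_def by (rule map_permutation_permutes) (use \<pi> inj in \<open>auto simp: bij_betw_def\<close>)
    then show "up \<pi> permutes ?N" by (rule permutes_subset) auto
    show "sign (up \<pi>) = sign \<pi>" unfolding up_def by (rule sign_map_permutation [OF inj \<pi>]) simp
    show "up \<pi> 0 = 0" "up \<pi> 1 = 1" by (rule permutes_not_in [OF *], auto)+
    show "up \<pi> (2 + i) = 2 + \<pi> i" if "i < 2 * k" for i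
      using map_permutation_apply [of "\<lambda>i. i + 2" "{..<2 * k}" i \<pi>] inj that by (simp add: up_def add.commute)
  qed
  have step: "of_int (sign \<sigma>) * B (v (\<sigma> 0)) (v (\<sigma> 1)) * pfaffian_sum k B (\<lambda>i. v (\<sigma> (2 + i)))
     = (\<Sum>\<pi> | \<pi> permutes {..<2 * k}. T (\<sigma> \<circ> up \<pi>))" if \<sigma>: "\<sigma> permutes ?N" for \<sigma>
  proof -
    have "of_int (sign \<sigma>) * B (v (\<sigma> 0)) (v (\<sigma> 1)) * (of_int (sign \<pi>) *
        (\<Prod>i<k. B (v (\<sigma> (2 + \<pi> (2 * i)))) (v (\<sigma> (2 + \<pi> (2 * i + 1)))))) = T (\<sigma> \<circ> up \<pi>)"
      if \<pi>: "\<pi> permutes {..<2 * k}" for \<pi>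
    proof -
      have "permutation \<sigma>" "permutation (up \<pi>)"
        using permutes_imp_permutation [of ?N] \<sigma> up(1) [OF \<pi>] by auto
      then have "sign (\<sigma> \<circ> up \<pi>) = sign \<sigma> * sign \<pi>"
        using up(2) [OF \<pi>] by (simp add: sign_compose)
      moreover have "(\<Prod>i<Suc k. B (v ((\<sigma> \<circ> up \<pi>) (2 * i))) (v ((\<sigma> \<circ> up \<pi>) (2 * i + 1))))
        = B (v (\<sigma> 0)) (v (\<sigma> 1)) * (\<Prod>i<k. B (v (\<sigma> (2 + \<pi> (2 * i)))) (v (\<sigma> (2 + \<pi> (2 * i + 1)))))"
      proof -
        have "up \<pi> (2 * Suc i) = 2 + \<pi> (2 * i)" "up \<pi> (2 * Suc i + 1) = 2 + \<pi> (2 * i + 1)" if "i < k" for i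
          using up(5) [OF \<pi>, of "2 * i"] up(5) [OF \<pi>, of "2 * i + 1"] that by simp_all
        then show ?thesis
          unfolding prod.lessThan_Suc_shift using up(3,4) [OF \<pi>] by simp
      qed
      ultimately show ?thesis by (simp add: T_def del: prod.lessThan_Suc)
    qed
    then show ?thesis unfolding pfaffian_sum_def sum_distrib_left by (intro sum.cong) auto
  qed
  have "wedge_power \<omega> (Suc k) x v = (\<Sum>\<sigma> | \<sigma> permutes ?N. of_int (sign \<sigma>) * of_real (B (v (\<sigma> 0)) (v (\<sigma> 1)))
        * of_real (pfaffian_sum k B (\<lambda>i. v (\<sigma> (2 + i))) / 2 ^ k)) / (fact 2 * fact (2 * k))"
    by (simp add: wedge_def assms Suc.IH)
  also have "\<dots> = of_real ((\<Sum>\<sigma> | \<sigma> permutes ?N. of_int (sign \<sigma>) * B (v (\<sigma> 0)) (v (\<sigma> 1))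
        * pfaffian_sum k B (\<lambda>i. v (\<sigma> (2 + i)))) / 2 ^ Suc k / fact (2 * k))"
    by (simp add: sum_divide_distrib mult_ac)
  also have "(\<Sum>\<sigma> | \<sigma> permutes ?N. of_int (sign \<sigma>) * B (v (\<sigma> 0)) (v (\<sigma> 1))
        * pfaffian_sum k B (\<lambda>i. v (\<sigma> (2 + i)))) = (\<Sum>\<sigma> | \<sigma> permutes ?N. \<Sum>\<pi> | \<pi> permutes {..<2 * k}. T (\<sigma> \<circ> up \<pi>))"
    by (rule sum.cong) (use step in auto)
  also have "\<dots> = (\<Sum>\<pi> | \<pi> permutes {..<2 * k}. \<Sum>\<sigma> | \<sigma> permutes ?N. T (\<sigma> \<circ> up \<pi>))" by (rule sum.swap)
  also have "\<dots> = (\<Sum>\<pi> | \<pi> permutes {..<2 * k}. pfaffian_sum (Suc k) B v)"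
    unfolding sum_T by (rule sum.cong [OF refl], rule sum_permutations_compose_right [symmetric], rule up(1)) simp
  also have "\<dots> = fact (2 * k) * pfaffian_sum (Suc k) B v"
    by (simp add: card_permutations [of "{..<2 * k}"])
  finally show ?case by simp
qed

lemma prod_pairs: "(\<Prod>i<k. f (2 * i) * f (2 * i + 1)) = (\<Prod>j<2 * k. f j :: 'a::comm_monoid_mult)" for k :: nat
  by (induction k) (simp_all add: mult.assoc)

lemma pfaffian_sum_scale:
  assumes B: "bilinear B"
  shows "pfaffian_sum k B (\<lambda>j. s j *\<^sub>R v j) = (\<Prod>j<2 * k. s j) * pfaffian_sum k B v"
proof -
  have "(\<Prod>i<k. B (s (\<sigma> (2 * i)) *\<^sub>R v (\<sigma> (2 * i))) (s (\<sigma> (2 * i + 1)) *\<^sub>R v (\<sigma> (2 * i + 1))))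
    = (\<Prod>j<2 * k. s j) * (\<Prod>i<k. B (v (\<sigma> (2 * i))) (v (\<sigma> (2 * i + 1))))"
    if "\<sigma> permutes {..<2 * k}" for \<sigma>
  proof -
    have "(\<Prod>i<k. B (s (\<sigma> (2 * i)) *\<^sub>R v (\<sigma> (2 * i))) (s (\<sigma> (2 * i + 1)) *\<^sub>R v (\<sigma> (2 * i + 1))))
      = (\<Prod>i<k. (s (\<sigma> (2 * i)) * s (\<sigma> (2 * i + 1))) * B (v (\<sigma> (2 * i))) (v (\<sigma> (2 * i + 1))))"
      by (simp add: bilinear_lmul [OF B] bilinear_rmul [OF B] mult_ac)
    also have "\<dots> = (\<Prod>j<2 * k. s (\<sigma> j)) * (\<Prod>i<k. B (v (\<sigma> (2 * i))) (v (\<sigma> (2 * i + 1))))"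
      by (simp only: prod.distrib flip: prod_pairs [of "\<lambda>j. s (\<sigma> j)" k])
    also have "(\<Prod>j<2 * k. s (\<sigma> j)) = (\<Prod>j<2 * k. s j)"
      using prod.permute [OF that, of s] by (simp add: o_def)
    finally show ?thesis .
  qed
  then show ?thesis
    unfolding pfaffian_sum_def sum_distrib_left by (intro sum.cong refl) simp
qed

lemma pfaffian_sum_axis_pos:
  fixes G :: "complex^'m::finite \<Rightarrow> complex^'m \<Rightarrow> real" and \<iota> :: "nat \<Rightarrow> 'm"
  assumes "bilinear G" "\<And>u. u \<noteq> 0 \<Longrightarrow> G u u > 0" "\<And>u v. G u v = G v u"
      "\<And>u v. G (cmplx_J u) (cmplx_J v) = G u v"
    and \<iota>: "inj_on \<iota> {..<k}"
  defines "u \<equiv> \<lambda>j. if even j then axis (\<iota> (j div 2)) 1 else cmplx_J (axis (\<iota> (j div 2)) 1)"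
  shows "0 < pfaffian_sum k (\<lambda>a b. G (cmplx_J a) b) u"
proof (rule pfaffian_sum_pos [where J = cmplx_J and G = G, OF _ _ assms(1-4)])
  show "linear (cmplx_J :: complex^'m \<Rightarrow> _)"
    by (rule linearI) (simp_all add: vec_eq_iff algebra_simps)
  show "cmplx_J (cmplx_J x) = - x" for x :: "complex^'m"
    by (simp add: vec_eq_iff)
  show "u (2 * j + 1) = cmplx_J (u (2 * j))" for j
    by (simp add: u_def)
  fix j assume "j < k"
  have "subspace {x :: complex^'m. x $ \<iota> j = 0}"
    by (rule subspaceI) auto
  moreover have "u ` {..<2 * j} \<subseteq> {x. x $ \<iota> j = 0}"
  proof clarify
    fix l assume "l < 2 * j"
    then have "l div 2 < j" by auto
    then have "\<iota> (l div 2) \<noteq> \<iota> j" using \<iota> \<open>j < k\<close> by (auto dest: inj_onD)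
    then show "u l $ \<iota> j = 0" by (simp add: u_def axis_def)
  qed
  ultimately have "span (u ` {..<2 * j}) \<subseteq> {x. x $ \<iota> j = 0}" by (intro span_minimal)
  moreover have "u (2 * j) $ \<iota> j = 1" by (simp add: u_def axis_def)
  ultimately show "u (2 * j) \<notin> span (u ` {..<2 * j})" by auto
qed

lemma smooth_on_pfaffian_sum:
  assumes "\<And>a b. smooth_on UNIV (\<lambda>y. B y a b)"
  shows "smooth_on UNIV (\<lambda>y. pfaffian_sum k (B y) v)"
  using assms unfolding smooth_on_def pfaffian_sum_def
  by (intro allI Ck_on_sum Ck_on_mult Ck_on_prod Ck_on_const) auto


section \<open>The Dolbeault operators under averaging\<close>

lemma fun_delbar_of_real:
  assumes "f differentiable (at y)"
  shows "fun_delbar (\<lambda>z. of_real (f z)) y b = Complex (dirderiv b f y / 2) (dirderiv (cmplx_J b) f y / 2)"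
proof -
  have "((\<lambda>z. of_real (f z)) has_derivative (\<lambda>v. of_real (frechet_derivative f (at y) v) :: complex)) (at y)"
    using assms unfolding frechet_derivative_works by (intro has_derivative_of_real)
  from frechet_derivative_at [OF this, symmetric] show ?thesis
    by (simp add: fun_delbar_def complex_eq_iff)
qed

lemma Im_fun_del:
  assumes "f differentiable (at x)" "h differentiable (at x)"
  shows "Im (fun_del (\<lambda>y. Complex (f y) (h y)) x a) = (dirderiv a h x - dirderiv (cmplx_J a) f x) / 2"
proof -
  have "((\<lambda>y. of_real (f y) + \<i> * of_real (h y)) has_derivative
      (\<lambda>v. of_real (frechet_derivative f (at x) v) + \<i> * of_real (frechet_derivative h (at x) v))) (at x)"
    using assms unfolding frechet_derivative_works
    by (intro has_derivative_add has_derivative_of_real has_derivative_mult_right)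
  then have "((\<lambda>y. Complex (f y) (h y)) has_derivative
      (\<lambda>v. Complex (frechet_derivative f (at x) v) (frechet_derivative h (at x) v))) (at x)"
    by (simp add: Complex_eq)
  from frechet_derivative_at [OF this, symmetric] show ?thesis
    by (simp add: fun_del_def)
qed

text \<open>Evaluated on \<open>e, J e, v 2, v 3, \<dots>\<close>, the form \<open>\<partial>\<delta> F\<close> is a sum over pairs (p, q) of second derivatives,
  taken in the directions of the p-th vector and of the q-th remaining one or of their multiples by
  \<open>\<i>\<close>.  The average kills every derivative along the span of the periods, so only the two pairs that
  use up \<open>e\<close> and \<open>J e\<close> contribute.  They add up to an imaginary multiple of the second derivative in the
  statement, which is why the imaginary part of the equation is the one that is kept.\<close>

lemma ddbar_average:
  fixes F :: "(nat \<Rightarrow> complex^'m::finite) \<Rightarrow> complex^'m \<Rightarrow> real"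
  assumes smooth: "\<And>v. smooth_on UNIV (F v)"
    and per: "\<And>v b y. b \<in> set bs \<Longrightarrow> F v (y + b) = F v y"
    and ddbar: "\<And>x. del (m + 1) (delbar m (\<lambda>y v. of_real (F v y))) x v = 0"
    and v0: "v 0 = e" and v1: "v 1 = cmplx_J e" and Je: "cmplx_J e \<in> span (set bs)"
    and fibre: "\<And>j. 2 \<le> j \<Longrightarrow> j \<le> m + 1 \<Longrightarrow> v j \<in> span (set bs) \<and> cmplx_J (v j) \<in> span (set bs)"
  shows "dirderiv e (dirderiv e (torus_avg bs (F (\<lambda>j. v (j + 2))))) x = 0"
proof -
  let ?D = dirderiv and ?J = "cmplx_J :: complex^'m \<Rightarrow> complex^'m"
  \<comment> \<open>Real and imaginary part of \<open>delbar\<close> of the form on the vectors other than the p-th.\<close>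
  define h1 where "h1 p y = (\<Sum>q\<le>m. ((-1) ^ q / 2) * ?D (omit p v q) (F (omit q (omit p v))) y)" for p y
  define h2 where "h2 p y = (\<Sum>q\<le>m. ((-1) ^ q / 2) * ?D (?J (omit p v q)) (F (omit q (omit p v))) y)" for p y
  have sm: "smooth_on UNIV (?D a (F w))" for a w by (intro smooth_on_dirderiv smooth)
  have smh: "smooth_on UNIV (h1 p)" "smooth_on UNIV (h2 p)" for p
    unfolding h1_def [abs_def] h2_def [abs_def] by (intro smooth_on_sum smooth_on_const_mult sm)+
  have perD: "?D a (F w) (y + b) = ?D a (F w) y" if "b \<in> set bs" for a w b y
  proof -
    have "(F w has_derivative frechet_derivative (F w) (at (y + b))) (at (y + b))"
      using smooth_on_differentiable [OF smooth] frechet_derivative_works by blast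
    moreover have "((\<lambda>z. z + b) has_derivative (\<lambda>v. v)) (at y)"
      by (auto intro!: derivative_eq_intros)
    ultimately have "((\<lambda>z. F w (z + b)) has_derivative frechet_derivative (F w) (at (y + b))) (at y)"
      using has_derivative_compose [of "\<lambda>z. z + b" "\<lambda>v. v" y UNIV "F w"] by simp
    then show ?thesis using frechet_derivative_at per [OF that] by force
  qed
  have perh: "h1 p (y + b) = h1 p y" "h2 p (y + b) = h2 p y" if "b \<in> set bs" for p b y
    using perD [OF that] by (simp_all add: h1_def h2_def)
  have kill: "torus_avg bs (?D a (F w)) = (\<lambda>_. 0)" if "a \<in> span (set bs)" for a w
    by (rule torus_avg_dirderiv_eq_0 [OF smooth per that])
  have killh: "torus_avg bs (?D a (h1 p)) = (\<lambda>_. 0)" "torus_avg bs (?D a (h2 p)) = (\<lambda>_. 0)"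
    if "a \<in> span (set bs)" for a p
    by (rule torus_avg_dirderiv_eq_0 [OF smh(1) perh(1) that], assumption)
       (rule torus_avg_dirderiv_eq_0 [OF smh(2) perh(2) that], assumption)
  have neg: "?D (- a) f x = - ?D a f x" if "smooth_on UNIV f" for a x and f :: "complex^'m \<Rightarrow> real"
    by (rule linear_neg [OF dirderiv_linear [OF smooth_on_differentiable [OF that]]])
  have JJ: "?J (?J a) = - a" for a by (simp add: vec_eq_iff)
  define A where "A = F (\<lambda>j. v (j + 2))"
  have om: "omit 0 (omit 0 v) = (\<lambda>j. v (j + 2))" "omit 0 (omit (Suc 0) v) = (\<lambda>j. v (j + 2))"
    by (auto simp: omit_def fun_eq_iff)
  have oms: "omit p v q = v (q + 1)" if "p \<le> 1" "q \<noteq> 0" for p q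
    using that by (auto simp: omit_def)
  \<comment> \<open>Only the summand q = 0 survives the average.\<close>
  have sh: "torus_avg bs (\<lambda>y. \<Sum>q\<le>m. ((-1) ^ q / 2) * ?D (a q) (F (w q)) y) = torus_avg bs (\<lambda>y. 1 / 2 * ?D (a 0) (F (w 0)) y)"
    if "\<And>q. q \<noteq> 0 \<Longrightarrow> q \<le> m \<Longrightarrow> a q \<in> span (set bs)" for a w
  proof -
    have "torus_avg bs (\<lambda>y. \<Sum>q\<le>m. ((-1) ^ q / 2) * ?D (a q) (F (w q)) y)
      = (\<lambda>y. \<Sum>q\<le>m. torus_avg bs (\<lambda>y. ((-1) ^ q / 2) * ?D (a q) (F (w q)) y) y)"
      by (intro torus_avg_sum smooth_on_continuous smooth_on_const_mult sm)
    also have "\<dots> = (\<lambda>y. \<Sum>q\<le>m. if q = 0 then torus_avg bs (\<lambda>y. 1 / 2 * ?D (a 0) (F (w 0)) y) y else 0)"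
    proof (intro ext sum.cong refl)
      fix y q assume "q \<in> {..m}"
      then show "torus_avg bs (\<lambda>y. ((-1) ^ q / 2) * ?D (a q) (F (w q)) y) y
        = (if q = 0 then torus_avg bs (\<lambda>y. 1 / 2 * ?D (a 0) (F (w 0)) y) y else 0)"
        using kill [OF that, of q "w q"] by (cases "q = 0") (simp_all only: torus_avg_mult, auto)
    qed
    finally show ?thesis by simp
  qed
  \<comment> \<open>The two surviving pairs: \<open>e\<close> is omitted first and \<open>J e\<close> second, or the other way round.\<close>
  have h20: "torus_avg bs (h2 0) = (\<lambda>y. (- 1 / 2) * ?D e (torus_avg bs A) y)"
  proof -
    have "torus_avg bs (h2 0) = torus_avg bs (\<lambda>y. 1 / 2 * ?D (?J (omit 0 v 0)) (F (omit 0 (omit 0 v))) y)"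
      unfolding h2_def by (rule sh) (use fibre oms in auto)
    also have "\<dots> = torus_avg bs (\<lambda>y. (- 1 / 2) * ?D e A y)"
      using v1 JJ neg [OF smooth] om by (simp add: omit_def A_def)
    also have "\<dots> = (\<lambda>y. (- 1 / 2) * ?D e (torus_avg bs A) y)"
      using fun_cong [OF dirderiv_torus_avg [OF smooth]] by (simp only: torus_avg_mult A_def)
    finally show ?thesis .
  qed
  have h11: "torus_avg bs (h1 1) = (\<lambda>y. 1 / 2 * ?D e (torus_avg bs A) y)"
  proof -
    have "torus_avg bs (h1 1) = torus_avg bs (\<lambda>y. 1 / 2 * ?D (omit 1 v 0) (F (omit 0 (omit 1 v))) y)"
      unfolding h1_def by (rule sh) (use fibre oms in auto)
    also have "\<dots> = torus_avg bs (\<lambda>y. 1 / 2 * ?D e A y)"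
      using v0 om by (simp add: omit_def A_def)
    also have "\<dots> = (\<lambda>y. 1 / 2 * ?D e (torus_avg bs A) y)"
      using fun_cong [OF dirderiv_torus_avg [OF smooth]] by (simp only: torus_avg_mult A_def)
    finally show ?thesis .
  qed
  have db: "delbar m (\<lambda>y v. of_real (F v y)) y (omit p v) = Complex (h1 p y) (h2 p y)" for p y
    unfolding delbar_def h1_def h2_def
    by (simp add: fun_delbar_of_real smooth_on_differentiable smooth complex_eq_iff)
  define E where "E p x = ?D (v p) (h2 p) x - ?D (?J (v p)) (h1 p) x" for p x
  \<comment> \<open>The imaginary part of the hypothesis, with the two halves of \<open>fun_del\<close> collected in \<open>E\<close>.\<close>
  have "(\<Sum>p\<le>m + 1. ((-1) ^ p / 2) * E p x) = 0" for x
  proof -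
    have "Im (del (m + 1) (delbar m (\<lambda>y v. of_real (F v y))) x v) = (\<Sum>p\<le>m + 1. ((-1) ^ p / 2) * E p x)"
      unfolding del_def db Im_sum E_def
    proof (intro sum.cong refl)
      fix p
      have "Im ((- 1) ^ p * z) = (- 1) ^ p * Im z" for z by (cases "even p") auto
      then show "Im ((- 1) ^ p * fun_del (\<lambda>y. Complex (h1 p y) (h2 p y)) x (v p)) =
         (- 1) ^ p / 2 * (?D (v p) (h2 p) x - ?D (?J (v p)) (h1 p) x)"
        by (simp add: Im_fun_del [OF smooth_on_differentiable [OF smh(1)] smooth_on_differentiable [OF smh(2)]])
    qed
    then show ?thesis using ddbar by simp
  qed
  then have zero: "torus_avg bs (\<lambda>x. \<Sum>p\<le>m + 1. ((-1) ^ p / 2) * E p x) x = 0" by (simp only: torus_avg_0)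
  have smE: "smooth_on UNIV (E p)" for p
  proof -
    have "E p = (\<lambda>x. ?D (v p) (h2 p) x + ?D (- ?J (v p)) (h1 p) x)"
      using neg [OF smh(1)] by (simp add: E_def fun_eq_iff)
    then show ?thesis
      using smooth_on_add [OF smooth_on_dirderiv [OF smh(2)] smooth_on_dirderiv [OF smh(1)]] by simp
  qed
  have avE: "torus_avg bs (E p) = (\<lambda>x. torus_avg bs (?D (v p) (h2 p)) x + torus_avg bs (?D (- ?J (v p)) (h1 p)) x)" for p
  proof -
    have "E p = (\<lambda>x. ?D (v p) (h2 p) x + ?D (- ?J (v p)) (h1 p) x)"
      using neg [OF smh(1)] by (simp add: E_def fun_eq_iff)
    then show ?thesis
      using torus_avg_add [OF smooth_on_continuous smooth_on_continuous, OF smooth_on_dirderiv smooth_on_dirderiv, OF smh(2) smh(1)]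
      by simp
  qed
  define d where "d = ?D e (?D e (torus_avg bs A)) x"
  have sA: "smooth_on UNIV (?D e (torus_avg bs A))"
    unfolding A_def by (intro smooth_on_dirderiv smooth_on_torus_avg smooth)
  have E0: "torus_avg bs (E 0) x = - 1 / 2 * d"
  proof -
    have "torus_avg bs (E 0) x = torus_avg bs (?D e (h2 0)) x"
      unfolding avE using killh(1) [OF span_neg [OF Je]] v0 by simp
    also have "\<dots> = ?D e (torus_avg bs (h2 0)) x" using fun_cong [OF dirderiv_torus_avg [OF smh(2)]] by (rule sym)
    also have "\<dots> = - 1 / 2 * d"
      unfolding h20 d_def by (rule dirderiv_cmult) (rule smooth_on_differentiable [OF sA])
    finally show ?thesis .
  qed
  have E1: "torus_avg bs (E 1) x = 1 / 2 * d"
  proof -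
    have "torus_avg bs (E 1) x = torus_avg bs (?D e (h1 1)) x"
      unfolding avE using killh(2) [OF Je] v1 JJ [of e] by simp
    also have "\<dots> = ?D e (torus_avg bs (h1 1)) x" using fun_cong [OF dirderiv_torus_avg [OF smh(1)]] by (rule sym)
    also have "\<dots> = 1 / 2 * d"
      unfolding h11 d_def by (rule dirderiv_cmult) (rule smooth_on_differentiable [OF sA])
    finally show ?thesis .
  qed
  have Ep: "torus_avg bs (E p) x = 0" if "2 \<le> p" "p \<le> m + 1" for p
    using fibre [OF that] by (simp add: avE killh(2) killh(1) [OF span_neg])
  have "0 = (\<Sum>p\<le>m + 1. ((-1) ^ p / 2) * torus_avg bs (E p) x)"
    using zero by (simp only: torus_avg_sum smooth_on_continuous smooth_on_const_mult smE torus_avg_mult)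
  also have "\<dots> = (\<Sum>p\<in>{0, 1}. ((-1) ^ p / 2) * torus_avg bs (E p) x)"
    by (rule sum.mono_neutral_right) (use Ep in auto)
  also have "\<dots> = - d / 2" using E0 E1 by simp
  finally show ?thesis by (simp add: d_def A_def)
qed


section \<open>Lifting the metric to the universal cover\<close>

lemma delbar_local:
  assumes "open V" "x \<in> V" "\<And>y. y \<in> V \<Longrightarrow> \<alpha> y = \<beta> y"
  shows "delbar k \<alpha> x v = delbar k \<beta> x v"
  unfolding delbar_def fun_delbar_def
  by (intro sum.cong refl) (simp add: frechet_derivative_local [OF assms(1,2), of "\<lambda>y. \<alpha> y _" "\<lambda>y. \<beta> y _"] assms(3))

lemma del_local:
  assumes "open V" "x \<in> V" "\<And>y. y \<in> V \<Longrightarrow> \<alpha> y = \<beta> y"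
  shows "del k \<alpha> x v = del k \<beta> x v"
  unfolding del_def fun_del_def
  by (intro sum.cong refl) (simp add: frechet_derivative_local [OF assms(1,2), of "\<lambda>y. \<alpha> y _" "\<lambda>y. \<beta> y _"] assms(3))

lemma wedge_power_local:
  fixes \<omega> \<omega>' :: "'m::finite form"
  assumes "\<omega> x = \<omega>' x"
  shows "wedge_power \<omega> k x = wedge_power \<omega>' k x"
  by (induction k) (auto simp: wedge_def assms fun_eq_iff)

text \<open>In the charts given by local sections of the projection, the transition maps are restrictions of
  the lattice elements.  The identity element shows that the local expressions of the metric agree on
  overlaps, the other ones that the resulting tensor is invariant.\<close>

lemma lift_hermitian_metric:
  fixes P :: "real^'n^'n" and lam :: "'n::finite \<Rightarrow> real" and \<tau> :: real
  defines "pr \<equiv> nak_proj lam P \<tau>"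
  assumes data: "nakamura_data M P lam \<tau>" and herm: "hermitian_metric (nak_atlas lam P \<tau>) g"
  obtains G where
    "\<And>V x. open V \<Longrightarrow> inj_on pr V \<Longrightarrow> x \<in> V \<Longrightarrow> G x = g (pr ` V, inv_into V pr) x"
    "\<And>\<gamma> x u v. \<gamma> \<in> nak_lattice P \<tau> \<Longrightarrow>
       G (\<gamma> + wz (w_of x) (nak_rho lam (w_of \<gamma>) *v z_of x)) (wz (w_of u) (nak_rho lam (w_of \<gamma>) *v z_of u))
         (wz (w_of v) (nak_rho lam (w_of \<gamma>) *v z_of v)) = G x u v"
proof -
  let ?lin = "\<lambda>\<gamma> y. wz (w_of y) (nak_rho lam (w_of \<gamma>) *v z_of y)"
  define chart where "chart V = (pr ` V, inv_into V pr)" for V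
  have in_atlas: "chart V \<in> nak_atlas lam P \<tau>" if "open V" "inj_on pr V" for V
    using that unfolding nak_atlas_def pr_def chart_def by auto
  have trans: "g (chart V') (\<gamma> + ?lin \<gamma> x) (?lin \<gamma> u) (?lin \<gamma> v) = g (chart V) x u v"
    if V: "open V" "inj_on pr V" "x \<in> V" and V': "open V'" "inj_on pr V'" "\<gamma> + ?lin \<gamma> x \<in> V'"
      and \<gamma>: "\<gamma> \<in> nak_lattice P \<tau>" for V V' \<gamma> x u v
  proof -
    let ?x' = "\<gamma> + ?lin \<gamma> x"
    have mult: "?x' = \<gamma> \<otimes>\<^bsub>nak_group lam\<^esub> x" by (rule mult_affine [symmetric])
    obtain T where T: "open T" "x \<in> T" "\<And>y. y \<in> T \<Longrightarrow> transition (chart V) (chart V') y = \<gamma> + ?lin \<gamma> y"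
      using atlas_transition [OF data V(1) V(2)[unfolded pr_def] V'(1) V'(2)[unfolded pr_def] V(3) V'(3) \<gamma> mult]
      unfolding chart_def pr_def by blast
    have "((\<lambda>y. \<gamma> + ?lin \<gamma> y) has_derivative ?lin \<gamma>) (at x)"
      using bounded_linear_imp_has_derivative [OF lin_bl] by (auto intro!: derivative_eq_intros)
    then have "(transition (chart V) (chart V') has_derivative ?lin \<gamma>) (at x)"
      by (rule has_derivative_transform_within_open [OF _ T(1,2)]) (use T(3) in auto)
    then have D: "frechet_derivative (transition (chart V) (chart V')) (at x) = ?lin \<gamma>"
      using frechet_derivative_at by metis
    have p: "pr x = pr ?x'"
      unfolding pr_def mult using pr_eq_iff [OF data, of x] \<gamma> by blast
    have c: "snd (chart V) (pr x) = x" "snd (chart V') (pr x) = ?x'"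
    proof -
      show "snd (chart V) (pr x) = x" using V by (simp add: chart_def)
      show "snd (chart V') (pr x) = ?x'" using V' by (simp add: chart_def p)
    qed
    have "pr x \<in> fst (chart V) \<inter> fst (chart V')" using V V' p by (auto simp: chart_def)
    then have "g (chart V') (snd (chart V') (pr x))
         (frechet_derivative (transition (chart V) (chart V')) (at (snd (chart V) (pr x))) u)
         (frechet_derivative (transition (chart V) (chart V')) (at (snd (chart V) (pr x))) v)
       = g (chart V) (snd (chart V) (pr x)) u v"
      using herm in_atlas [OF V(1,2)] in_atlas [OF V'(1,2)] unfolding hermitian_metric_def by blast
    then show ?thesis by (simp only: c D)
  qed
  define nb where "nb x = (SOME V. open V \<and> x \<in> V \<and> inj_on pr V)" for x
  have nb: "open (nb x)" "x \<in> nb x" "inj_on pr (nb x)" for x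
    using someI_ex [OF local_chart [OF data, of x, folded pr_def]] unfolding nb_def by auto
  define G where "G x = g (chart (nb x)) x" for x
  have L0: "0 \<in> nak_lattice P \<tau>" by (simp add: lattice_iff base_0 fibre_0)
  have lin0: "wz (w_of y) (nak_rho lam 0 *v z_of y) = y" for y by (simp add: wz_eq_iff vec_eq_iff nak_rho_nth)
  show ?thesis
  proof (rule that)
    show "G x = g (pr ` V, inv_into V pr) x" if "open V" "inj_on pr V" "x \<in> V" for V x
      using trans [OF that nb(1,3), of 0 x] nb(2) [of x] L0
      by (simp add: lin0 G_def chart_def fun_eq_iff)
    show "G (\<gamma> + ?lin \<gamma> x) (?lin \<gamma> u) (?lin \<gamma> v) = G x u v" if "\<gamma> \<in> nak_lattice P \<tau>" for \<gamma> x u v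
      unfolding G_def by (rule trans [OF nb(1,3,2) nb(1,3,2) that])
  qed
qed

text \<open>Smoothness, positivity and the differential equation are local, hence inherited from the charts.\<close>

lemma lift_astheno_kahler:
  fixes P :: "real^'n^'n" and lam :: "'n::finite \<Rightarrow> real"
    and g :: "((complex^('n option)) set, 'n option) metric_tensor"
  defines "k \<equiv> CARD('n option) - 2"
  assumes data: "nakamura_data M P lam \<tau>" and ak: "astheno_kahler (nak_atlas lam P \<tau>) g"
  obtains G where "\<And>a b. smooth_on UNIV (\<lambda>x. G x a b)"
    "\<And>x. bilinear (G x)" "\<And>x u v. G x u v = G x v u" "\<And>x u. u \<noteq> 0 \<Longrightarrow> G x u u > 0"
    "\<And>x u v. G x (cmplx_J u) (cmplx_J v) = G x u v"
    "\<And>\<gamma> x u v. \<gamma> \<in> nak_lattice P \<tau> \<Longrightarrow>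
       G (\<gamma> + wz (w_of x) (nak_rho lam (w_of \<gamma>) *v z_of x)) (wz (w_of u) (nak_rho lam (w_of \<gamma>) *v z_of u))
         (wz (w_of v) (nak_rho lam (w_of \<gamma>) *v z_of v)) = G x u v"
    "\<And>x v. del (2 * k + 1) (delbar (2 * k)
       (wedge_power (\<lambda>x v. of_real (G x (cmplx_J (v 0)) (v 1))) k)) x v = 0"
proof -
  let ?pr = "nak_proj lam P \<tau>"
  let ?lin = "\<lambda>\<gamma> y. wz (w_of y) (nak_rho lam (w_of \<gamma>) *v z_of y)"
  let ?J = "cmplx_J :: complex^('n option) \<Rightarrow> complex^('n option)"
  have herm: "hermitian_metric (nak_atlas lam P \<tau>) g"
    and ast: "\<And>c x v. c \<in> nak_atlas lam P \<tau> \<Longrightarrow> x \<in> chart_image c \<Longrightarrow>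
      del (2 * k + 1) (delbar (2 * k) (wedge_power (fundamental_form g c) k)) x v = 0"
    using ak unfolding astheno_kahler_def k_def Let_def by blast+
  obtain G where G: "\<And>V x. open V \<Longrightarrow> inj_on ?pr V \<Longrightarrow> x \<in> V \<Longrightarrow> G x = g (?pr ` V, inv_into V ?pr) x"
    and G_inv: "\<And>\<gamma> x u v. \<gamma> \<in> nak_lattice P \<tau> \<Longrightarrow> G (\<gamma> + ?lin \<gamma> x) (?lin \<gamma> u) (?lin \<gamma> v) = G x u v"
    using lift_hermitian_metric [OF data herm] by metis
  have chart: "\<exists>V. open V \<and> x \<in> V \<and> inj_on ?pr V \<and> (?pr ` V, inv_into V ?pr) \<in> nak_atlas lam P \<tau>
      \<and> chart_image (?pr ` V, inv_into V ?pr) = V" for x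
  proof -
    obtain V where V: "open V" "x \<in> V" "inj_on ?pr V" using local_chart [OF data] by blast
    then have "chart_image (?pr ` V, inv_into V ?pr) = V"
      by (auto simp: chart_image_def image_image)
    with V show ?thesis unfolding nak_atlas_def by blast
  qed
  have G_smooth: "smooth_on UNIV (\<lambda>x. G x a b)" for a b
    unfolding smooth_on_def
  proof (intro allI Ck_on_locally)
    fix l and x :: "complex^('n option)"
    obtain V where V: "open V" "x \<in> V" "inj_on ?pr V" "(?pr ` V, inv_into V ?pr) \<in> nak_atlas lam P \<tau>"
      "chart_image (?pr ` V, inv_into V ?pr) = V" using chart by blast
    have "Ck_on l V (\<lambda>x. g (?pr ` V, inv_into V ?pr) x a b)"
      using herm V(4,5) unfolding hermitian_metric_def smooth_on_def by metis
    then have "Ck_on l V (\<lambda>x. G x a b)"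
      by (rule Ck_on_cong [OF V(1), rotated]) (simp add: G [OF V(1,3)])
    with V show "\<exists>T. open T \<and> x \<in> T \<and> Ck_on l T (\<lambda>x. G x a b)" by blast
  qed
  have G_herm: "bilinear (G x)" "\<And>u v. G x u v = G x v u" "\<And>u. u \<noteq> 0 \<Longrightarrow> G x u u > 0"
    "\<And>u v. G x (?J u) (?J v) = G x u v" for x
  proof -
    obtain V where V: "open V" "x \<in> V" "inj_on ?pr V" "(?pr ` V, inv_into V ?pr) \<in> nak_atlas lam P \<tau>"
      "chart_image (?pr ` V, inv_into V ?pr) = V" using chart by blast
    have "bilinear (G x) \<and> (\<forall>u v. G x u v = G x v u) \<and> (\<forall>u. u \<noteq> 0 \<longrightarrow> G x u u > 0) \<and>
        (\<forall>u v. G x (?J u) (?J v) = G x u v)"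
      using herm V(2,4,5) unfolding hermitian_metric_def G [OF V(1,3,2)] by blast
    then show "bilinear (G x)" "\<And>u v. G x u v = G x v u" "\<And>u. u \<noteq> 0 \<Longrightarrow> G x u u > 0"
      "\<And>u v. G x (?J u) (?J v) = G x u v" by blast+
  qed
  define \<Omega> where "\<Omega> x v = complex_of_real (G x (?J (v 0)) (v 1))" for x and v :: "nat \<Rightarrow> complex^('n option)"
  have ddbar: "del (2 * k + 1) (delbar (2 * k) (wedge_power \<Omega> k)) x v = 0" for x v
  proof -
    obtain V where V: "open V" "x \<in> V" "inj_on ?pr V" "(?pr ` V, inv_into V ?pr) \<in> nak_atlas lam P \<tau>"
      "chart_image (?pr ` V, inv_into V ?pr) = V" using chart by blast
    let ?\<omega> = "fundamental_form g (?pr ` V, inv_into V ?pr)"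
    have "\<Omega> y = ?\<omega> y" if "y \<in> V" for y
      by (simp add: \<Omega>_def fundamental_form_def G [OF V(1,3) that] fun_eq_iff)
    then have "wedge_power \<Omega> k y = wedge_power ?\<omega> k y" if "y \<in> V" for y
      using that by (intro wedge_power_local) auto
    then have "delbar (2 * k) (wedge_power \<Omega> k) y = delbar (2 * k) (wedge_power ?\<omega> k) y" if "y \<in> V" for y
      using that V(1) by (intro ext delbar_local) auto
    then have "del (2 * k + 1) (delbar (2 * k) (wedge_power \<Omega> k)) x v
        = del (2 * k + 1) (delbar (2 * k) (wedge_power ?\<omega> k)) x v"
      using V(1,2) by (intro del_local) auto
    then show ?thesis using ast [OF V(4)] V(2,5) by simp
  qed
  show ?thesis
    by (rule that [OF G_smooth G_herm G_inv]) (use ddbar in \<open>simp_all add: \<Omega>_def [abs_def]\<close>)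
qed


section \<open>The lattice\<close>

text \<open>As \<open>\<rho>\<close> is trivial for \<open>Re w = 0\<close>, these lattice elements act on the universal cover by translations.\<close>

definition flat_periods :: "real^'n^'n \<Rightarrow> real \<Rightarrow> (complex^('n::finite option)) set" where
  "flat_periods P \<tau> = {x. Re (w_of x) = 0 \<and> x \<in> nak_lattice P \<tau>}"

lemma flat_periods_closed:
  "0 \<in> flat_periods P \<tau>"
  "x \<in> flat_periods P \<tau> \<Longrightarrow> y \<in> flat_periods P \<tau> \<Longrightarrow> x + y \<in> flat_periods P \<tau>"
  "x \<in> flat_periods P \<tau> \<Longrightarrow> - x \<in> flat_periods P \<tau>"
proof -
  have add: "w_of (x + y) = w_of x + w_of y" "z_of (x + y) = z_of x + z_of y"
    and neg: "w_of (- x) = - w_of x" "z_of (- x) = - z_of x" for x y :: "complex^('a option)"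
    by (simp_all add: w_of_def z_of_def vec_eq_iff)
  show "0 \<in> flat_periods P \<tau>"
    by (simp add: flat_periods_def lattice_iff base_0 fibre_0)
  show "x \<in> flat_periods P \<tau> \<Longrightarrow> y \<in> flat_periods P \<tau> \<Longrightarrow> x + y \<in> flat_periods P \<tau>"
    by (simp add: flat_periods_def lattice_iff add base_add fibre_add)
  show "x \<in> flat_periods P \<tau> \<Longrightarrow> - x \<in> flat_periods P \<tau>"
    by (simp add: flat_periods_def lattice_iff neg base_uminus fibre_uminus)
qed

lemma vec_option_eqI:
  fixes x y :: "'a^('n::finite option)"
  assumes "x $ None = y $ None" "\<And>i. x $ Some i = y $ Some i"
  shows "x = y"
proof -
  have "x $ j = y $ j" for j using assms by (cases j) auto
  then show ?thesis by (simp add: vec_eq_iff)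
qed

lemma span_flat_periods:
  fixes P :: "real^'n^'n::finite"
  assumes P: "invertible P" and \<tau>: "\<tau> \<noteq> 0"
  obtains bs where "set bs \<subseteq> flat_periods P \<tau>" "span (set bs) = {x. Re (w_of x) = 0}"
proof -
  define b0 :: "complex^('n option)" where "b0 = wz (\<i> * of_real \<tau>) 0"
  define b1 :: "'n \<Rightarrow> complex^('n option)" where "b1 j = wz 0 (\<chi> i. of_real (P $ i $ j))" for j
  define b2 :: "'n \<Rightarrow> complex^('n option)" where "b2 j = wz 0 (\<chi> i. \<i> * of_real (P $ i $ j))" for j
  let ?S = "{b0} \<union> range b1 \<union> range b2"
  obtain bs where bs: "set bs = ?S" using finite_list [of ?S] by auto
  have iv: "intvec (axis j 1)" "intvec 0" for j :: 'n by (auto simp: intvec_def axis_def)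
  have col: "(P *v axis j 1) $ i = P $ i $ j" for i j
    by (simp add: matrix_vector_mult_def axis_def if_distrib cong: if_cong)
  have "b0 \<in> flat_periods P \<tau>"
  proof -
    have "\<i> * of_real \<tau> \<in> nak_base_lattice \<tau>"
      unfolding nak_base_lattice_def by (rule CollectI, rule exI [of _ 0], rule exI [of _ 1]) simp
    then show ?thesis by (simp add: flat_periods_def lattice_iff b0_def fibre_0)
  qed
  moreover have "b1 j \<in> flat_periods P \<tau>" for j
  proof -
    have "z_of (b1 j) \<in> nak_fibre_lattice P"
      unfolding nak_fibre_lattice_iff
      by (rule exI [of _ "axis j 1"], rule exI [of _ "0"]) (use iv col in \<open>simp add: b1_def complex_eq_iff\<close>)
    then show ?thesis by (simp add: flat_periods_def lattice_iff base_0 b1_def)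
  qed
  moreover have "b2 j \<in> flat_periods P \<tau>" for j
  proof -
    have "z_of (b2 j) \<in> nak_fibre_lattice P"
      unfolding nak_fibre_lattice_iff
      by (rule exI [of _ "0"], rule exI [of _ "axis j 1"]) (use iv col in \<open>simp add: b2_def complex_eq_iff\<close>)
    then show ?thesis by (simp add: flat_periods_def lattice_iff base_0 b2_def)
  qed
  ultimately have sub: "set bs \<subseteq> flat_periods P \<tau>" using bs by auto
  have "span (set bs) \<subseteq> {x. Re (w_of x) = 0}"
  proof (rule span_minimal)
    show "subspace {x :: complex^('n option). Re (w_of x) = 0}"
      by (rule subspaceI) (simp_all add: w_of_def)
  qed (use sub in \<open>auto simp: flat_periods_def\<close>)
  moreover have "x \<in> span (set bs)" if x: "Re (w_of x) = 0" for x
  proof -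
    obtain B where B: "P ** B = mat 1" using P unfolding invertible_def by blast
    define r where "r = B *v (\<chi> i. Re (z_of x $ i))"
    define t where "t = B *v (\<chi> i. Im (z_of x $ i))"
    have r: "(\<Sum>j\<in>UNIV. P $ i $ j * r $ j) = Re (z_of x $ i)" for i
    proof -
      have "P *v r = (\<chi> i. Re (z_of x $ i))" by (simp add: r_def matrix_vector_mul_assoc B)
      then show ?thesis by (simp add: matrix_vector_mult_def vec_eq_iff)
    qed
    have t: "(\<Sum>j\<in>UNIV. P $ i $ j * t $ j) = Im (z_of x $ i)" for i
    proof -
      have "P *v t = (\<chi> i. Im (z_of x $ i))" by (simp add: t_def matrix_vector_mul_assoc B)
      then show ?thesis by (simp add: matrix_vector_mult_def vec_eq_iff)
    qed
    have "x = (Im (w_of x) / \<tau>) *\<^sub>R b0 + (\<Sum>j\<in>UNIV. r $ j *\<^sub>R b1 j) + (\<Sum>j\<in>UNIV. t $ j *\<^sub>R b2 j)"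
    proof -
      let ?y = "(Im (w_of x) / \<tau>) *\<^sub>R b0 + (\<Sum>j\<in>UNIV. r $ j *\<^sub>R b1 j) + (\<Sum>j\<in>UNIV. t $ j *\<^sub>R b2 j)"
      have "x $ None = ?y $ None"
        using x \<tau> by (simp add: b0_def b1_def b2_def wz_def w_of_def complex_eq_iff)
      moreover have "x $ Some i = ?y $ Some i" for i
        using r [of i] t [of i] by (simp add: b0_def b1_def b2_def wz_def z_of_nth complex_eq_iff mult.commute)
      ultimately show ?thesis by (rule vec_option_eqI)
    qed
    also have "\<dots> \<in> span (set bs)"
      using bs by (intro span_add span_scale span_sum) (auto intro: span_base)
    finally show ?thesis .
  qed
  ultimately show ?thesis using that [OF sub] by blast
qed

text \<open>Rounding down the coefficients of a combination of the vectors splits off an element of the group and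
  leaves a rest in the parallelepiped that they span.\<close>

lemma compact_fundamental_domain:
  fixes bs :: "'a::real_normed_vector list"
  assumes L: "0 \<in> L" "\<And>x y. x \<in> L \<Longrightarrow> y \<in> L \<Longrightarrow> x + y \<in> L" "\<And>x. x \<in> L \<Longrightarrow> - x \<in> L"
    and bs: "set bs \<subseteq> L"
  shows "\<exists>K. compact K \<and> (\<forall>s\<in>span (set bs). \<exists>x\<in>K. \<exists>l\<in>L. s = x + l)"
  using bs
proof (induction bs)
  case Nil
  then show ?case using L(1) by (intro exI [of _ "{0}"]) auto
next
  case (Cons b bs)
  then obtain K where K: "compact K" "\<And>s. s \<in> span (set bs) \<Longrightarrow> \<exists>x\<in>K. \<exists>l\<in>L. s = x + l" by auto
  have nat: "real m *\<^sub>R b \<in> L" for m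
    by (induction m) (use L Cons.prems in \<open>auto simp: scaleR_add_left\<close>)
  have int: "of_int m *\<^sub>R b \<in> L" for m
    using nat [of "nat m"] L(3) [OF nat [of "nat (- m)"]] by (cases "m \<ge> 0") auto
  define K' where "K' = {x + y |x y. x \<in> K \<and> y \<in> (\<lambda>t. t *\<^sub>R b) ` {0..1}}"
  have "compact K'"
    unfolding K'_def by (intro compact_sums K compact_continuous_image continuous_intros) auto
  moreover have "\<exists>x\<in>K'. \<exists>l\<in>L. s = x + l" if s: "s \<in> span (set (b # bs))" for s
  proof -
    obtain r where "s - r *\<^sub>R b \<in> span (set bs)"
      using s span_breakdown_eq [of s b "set bs"] by auto
    then obtain x l where x: "x \<in> K" "l \<in> L" "s - r *\<^sub>R b = x + l" using K(2) by blast
    have "r *\<^sub>R b = frac r *\<^sub>R b + of_int \<lfloor>r\<rfloor> *\<^sub>R b"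
      by (simp add: frac_def flip: scaleR_add_left)
    then have "s = (x + frac r *\<^sub>R b) + (l + of_int \<lfloor>r\<rfloor> *\<^sub>R b)"
      using x(3) by (simp add: algebra_simps)
    moreover have "x + frac r *\<^sub>R b \<in> K'"
    proof -
      have "frac r *\<^sub>R b \<in> (\<lambda>t. t *\<^sub>R b) ` {0..1}"
        using frac_lt_1 [of r] frac_ge_0 [of r] by (intro imageI) simp
      then show ?thesis using x(1) unfolding K'_def by blast
    qed
    ultimately show ?thesis using L(2) [OF x(2) int] by blast
  qed
  ultimately show ?case by blast
qed

text \<open>The exponential of the sum is \<open>det M\<close>.\<close>

lemma sum_lam_eq_0:
  assumes "nakamura_data M P lam \<tau>"
  shows "(\<Sum>i\<in>UNIV. lam i) = 0"
proof -
  let ?M = "map_matrix of_int M :: real^'a^'a"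
  have inv: "P ** matrix_inv P = mat 1"
    using assms someI_ex [of "\<lambda>B. P ** B = mat 1 \<and> B ** P = mat 1"]
    by (simp add: nakamura_data_def invertible_def matrix_inv_def)
  have "exp (\<Sum>i\<in>UNIV. lam i) = det (diag_mat (\<lambda>i. exp (lam i)) :: real^'a^'a)"
    by (subst det_diagonal) (simp_all add: diag_mat_def exp_sum)
  also have "\<dots> = det (P ** ?M ** matrix_inv P)" using assms by (simp add: nakamura_data_def)
  also have "\<dots> = det (P ** matrix_inv P) * det ?M" by (simp add: det_mul)
  also have "\<dots> = 1" using assms by (simp add: inv det_of_int nakamura_data_def)
  finally show ?thesis by simp
qed


section \<open>Nonexistence of astheno-Kaehler metrics\<close>

lemma affine_not_exponential:
  fixes c \<epsilon> :: real
  assumes "1 < c" "0 < \<epsilon>"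
  shows "\<exists>m. a + b * real m < \<epsilon> * c ^ m"
proof -
  have "(\<lambda>m. a * (1 / c) ^ m + b * (real m * (1 / c) ^ m)) \<longlonglongrightarrow> a * 0 + b * 0"
    using assms(1) by (intro tendsto_intros LIMSEQ_power_zero powser_times_n_limit_0) auto
  then have "\<forall>\<^sub>F m in sequentially. a * (1 / c) ^ m + b * (real m * (1 / c) ^ m) < \<epsilon>"
    using assms(2) by (intro order_tendstoD(2)) auto
  then obtain m where "a * (1 / c) ^ m + b * (real m * (1 / c) ^ m) < \<epsilon>"
    using eventually_happens by force
  then show ?thesis using assms(1) by (intro exI [of _ m]) (simp add: field_simps)
qed
theorem proposition4p6:
  fixes M :: "int^'n^'n" and P :: "real^'n^'n"
    and lam :: "'n::finite \<Rightarrow> real" and \<tau> :: real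
  assumes "nakamura_data M P lam \<tau>"
    and "\<exists>i. lam i \<noteq> 0"
  shows "\<not> (\<exists>g. astheno_kahler (nak_atlas lam P \<tau>) g)"
proof
  note data = assms(1)
  let ?lin = "\<lambda>\<gamma> y. wz (w_of y) (nak_rho lam (w_of \<gamma>) *v z_of y)"
  let ?J = "cmplx_J :: complex^('n option) \<Rightarrow> complex^('n option)"
  define k where "k = CARD('n option) - 2"
  assume "\<exists>g. astheno_kahler (nak_atlas lam P \<tau>) g"
  then obtain g where ak: "astheno_kahler (nak_atlas lam P \<tau>) g" by blast
  obtain G where G_smooth: "\<And>a b. smooth_on UNIV (\<lambda>x. G x a b)"
    and G_herm: "\<And>x. bilinear (G x)" "\<And>x u v. G x u v = G x v u" "\<And>x u. u \<noteq> 0 \<Longrightarrow> G x u u > 0"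
      "\<And>x u v. G x (?J u) (?J v) = G x u v"
    and G_inv: "\<And>\<gamma> x u v. \<gamma> \<in> nak_lattice P \<tau> \<Longrightarrow> G (\<gamma> + ?lin \<gamma> x) (?lin \<gamma> u) (?lin \<gamma> v) = G x u v"
    and G_ddbar: "\<And>x v. del (2 * k + 1) (delbar (2 * k)
      (wedge_power (\<lambda>x v. of_real (G x (?J (v 0)) (v 1))) k)) x v = 0"
  proof (rule lift_astheno_kahler [OF data ak, folded k_def], goal_cases)
    case (1 G)
    from 1(2-) show ?thesis by (rule 1(1))
  qed
  define B where "B y a b = G y (?J a) b" for y a b
  define F where "F v y = pfaffian_sum k (B y) v / 2 ^ k" for v y
  define \<Omega> where "\<Omega> x v = complex_of_real (G x (?J (v 0)) (v 1))" for x and v :: "nat \<Rightarrow> complex^('n option)"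
  have B_bil: "bilinear (B y)" for y
  proof -
    have "linear ?J" by (rule linearI) (simp_all add: vec_eq_iff algebra_simps)
    from linear_compose [OF this, of "\<lambda>a. G y a _"] show ?thesis
      using G_herm(1) [of y] unfolding bilinear_def B_def o_def by blast
  qed
  have F_smooth: "smooth_on UNIV (F v)" for v
  proof -
    have "smooth_on UNIV (\<lambda>y. (1 / 2 ^ k) * pfaffian_sum k (B y) v)"
      unfolding B_def by (intro smooth_on_const_mult smooth_on_pfaffian_sum G_smooth)
    then show ?thesis unfolding F_def [abs_def] by simp
  qed
  have power: "wedge_power \<Omega> k = (\<lambda>y v. of_real (F v y))"
    unfolding F_def by (intro ext wedge_power_eq_pfaffian_sum) (simp add: \<Omega>_def B_def)
  have ddbar: "del (2 * k + 1) (delbar (2 * k) (\<lambda>y v. of_real (F v y))) x v = 0" for x v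
    using G_ddbar [of x v] by (simp only: power \<Omega>_def [abs_def, symmetric])
  have "\<exists>i. lam i > 0"
  proof (rule ccontr)
    assume "\<not> (\<exists>i. lam i > 0)"
    then have np: "- lam i \<ge> 0" for i by (simp add: not_less)
    have "(\<Sum>i\<in>UNIV. - lam i) = 0" using sum_lam_eq_0 [OF data] by (simp add: sum_negf)
    then have "- lam i = 0" for i
      using sum_nonneg_eq_0_iff [of UNIV "\<lambda>i. - lam i"] np by simp
    then show False using assms(2) by auto
  qed
  then obtain i0 where i0: "lam i0 > 0" by blast
  have "card (UNIV - {i0}) = k" by (simp add: k_def)
  then obtain \<iota>0 where \<iota>0: "bij_betw \<iota>0 {..<k} (UNIV - {i0})"
    using ex_bij_betw_nat_finite [of "UNIV - {i0}"] by (auto simp: atLeast0LessThan)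
  \<comment> \<open>\<open>\<iota>\<close> enumerates the directions \<open>z\<^sub>j\<close> other than the one of \<open>i0\<close>; \<open>u\<close> lists each of them, followed by
    its multiple by \<open>\<i>\<close>, as a real basis.\<close>
  define \<iota> where "\<iota> j = Some (\<iota>0 j)" for j
  define u where "u = (\<lambda>j. if even j then axis (\<iota> (j div 2)) 1 else ?J (axis (\<iota> (j div 2)) 1))"
  define e :: "complex^('n option)" where "e = axis None 1"
  define A where "A = F u"
  have w_u: "w_of (u j) = 0" "w_of (?J (u j)) = 0" for j
    by (simp_all add: u_def w_of_def axis_def \<iota>_def)
  have A_pos: "0 < A y" for y
  proof -
    have "inj_on \<iota> {..<k}" using \<iota>0 by (auto simp: \<iota>_def bij_betw_def inj_on_def)
    from pfaffian_sum_axis_pos [OF G_herm(1) G_herm(3,2,4) this] show ?thesis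
      by (simp add: A_def F_def B_def [abs_def] u_def)
  qed
  define \<gamma> :: "complex^('n option)" where "\<gamma> = wz 1 0"
  have \<gamma>: "\<gamma> \<in> nak_lattice P \<tau>"
  proof -
    have "1 \<in> nak_base_lattice \<tau>"
      unfolding nak_base_lattice_def by (rule CollectI, rule exI [of _ 1], rule exI [of _ 0]) simp
    then show ?thesis by (simp add: lattice_iff \<gamma>_def fibre_0)
  qed
  define c where "c = exp (2 * lam i0)"
  \<comment> \<open>Invariance under \<open>\<gamma>\<close>, which multiplies the j-th pair of arguments of A by \<open>exp \<lambda>\<^sub>j\<close>.\<close>
  have A_\<gamma>: "A (\<gamma> + ?lin \<gamma> y) = c * A y" for y
  proof -
    let ?s = "\<lambda>j. exp (lam (\<iota>0 (j div 2)))"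
    have lin_u: "?lin \<gamma> (u j) = ?s j *\<^sub>R u j" for j
    proof -
      have "?lin \<gamma> (u j) $ None = (?s j *\<^sub>R u j) $ None"
        using w_u(1) [of j] by (simp add: w_of_def wz_def)
      moreover have "?lin \<gamma> (u j) $ Some i = (?s j *\<^sub>R u j) $ Some i" for i
      proof -
        have "w_of \<gamma> = 1" by (simp add: \<gamma>_def)
        then have "?lin \<gamma> (u j) $ Some i = of_real (exp (lam i)) * u j $ Some i"
          by (simp add: wz_def nak_rho_nth z_of_nth flip: exp_of_real)
        then show ?thesis by (auto simp: u_def axis_def \<iota>_def scaleR_complex.ctr complex_eq_iff)
      qed
      ultimately show ?thesis by (rule vec_option_eqI)
    qed
    have "pfaffian_sum k (B y) u = pfaffian_sum k (B (\<gamma> + ?lin \<gamma> y)) (\<lambda>j. ?lin \<gamma> (u j))"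
      unfolding pfaffian_sum_def B_def lin_J [symmetric] G_inv [OF \<gamma>] ..
    also have "\<dots> = (\<Prod>j<2 * k. ?s j) * pfaffian_sum k (B (\<gamma> + ?lin \<gamma> y)) u"
      unfolding lin_u by (rule pfaffian_sum_scale [OF B_bil])
    also have "(\<Prod>j<2 * k. ?s j) = (\<Prod>i<k. exp (2 * lam (\<iota>0 i)))"
      by (simp flip: prod_pairs exp_add)
    also have "\<dots> = exp (2 * (\<Sum>i<k. lam (\<iota>0 i)))"
      by (simp add: exp_sum sum_distrib_left)
    also have "(\<Sum>i<k. lam (\<iota>0 i)) = (\<Sum>i\<in>UNIV - {i0}. lam i)"
      by (rule sum.reindex_bij_betw [OF \<iota>0])
    also have "\<dots> = - lam i0"
      using sum_lam_eq_0 [OF data] by (simp add: sum_diff1)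
    finally show ?thesis by (simp add: A_def F_def c_def exp_minus field_simps)
  qed
  have "invertible P" "\<tau> \<noteq> 0" using data by (simp_all add: nakamura_data_def)
  then obtain bs where bs: "set bs \<subseteq> flat_periods P \<tau>" and span_bs: "span (set bs) = {x. Re (w_of x) = 0}"
    by (rule span_flat_periods)
  have F_per: "F v (y + b) = F v y" if b: "b \<in> flat_periods P \<tau>" for v y b
  proof -
    have lin: "?lin b x = x" for x
      using b by (simp add: flat_periods_def wz_eq_iff vec_eq_iff nak_rho_nth)
    have "G (y + b) x z = G y x z" for x z
      using G_inv [of b y x z] b by (simp add: lin flat_periods_def add.commute)
    then have "B (y + b) = B y" by (simp add: B_def fun_eq_iff)
    then show ?thesis by (simp add: F_def)
  qed
  \<comment> \<open>The mean of A over the fibre and over \<open>Im w\<close>, to be shown affine along the real w-axis.\<close>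
  define \<Phi> where "\<Phi> = torus_avg bs A"
  have \<Phi>'': "dirderiv e (dirderiv e \<Phi>) x = 0" for x
  proof -
    \<comment> \<open>The list u preceded by the two real directions of w.\<close>
    define v where "v j = (case j of 0 \<Rightarrow> e | Suc 0 \<Rightarrow> ?J e | Suc (Suc j) \<Rightarrow> u j)" for j
    have "(\<lambda>j. v (j + 2)) = u" by (simp add: v_def)
    moreover have "dirderiv e (dirderiv e (torus_avg bs (F (\<lambda>j. v (j + 2))))) x = 0"
    proof (rule ddbar_average [OF F_smooth _ ddbar])
      show "v 0 = e" "v 1 = ?J e" by (simp_all add: v_def)
      show "?J e \<in> span (set bs)" by (simp add: span_bs e_def w_of_def axis_def)
      show "v j \<in> span (set bs) \<and> ?J (v j) \<in> span (set bs)" if "2 \<le> j" "j \<le> 2 * k + 1" for j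
      proof -
        have "j = Suc (Suc (j - 2))" using that by simp
        then have "v j = u (j - 2)" unfolding v_def by (metis nat.case(2))
        then show ?thesis using w_u by (simp add: span_bs)
      qed
      show "F v (y + b) = F v y" if "b \<in> set bs" for v y b
        using F_per that bs by blast
    qed
    ultimately show ?thesis by (simp add: \<Phi>_def A_def)
  qed
  have A_smooth: "smooth_on UNIV A" unfolding A_def by (rule F_smooth)
  have \<Phi>_smooth: "smooth_on UNIV \<Phi>" unfolding \<Phi>_def by (intro smooth_on_torus_avg A_smooth)
  have along: "((\<lambda>t. h (t *\<^sub>R e)) has_real_derivative dirderiv e h (t *\<^sub>R e)) (at t)"
    if "smooth_on UNIV h" for h :: "complex^('n option) \<Rightarrow> real" and t
  proof -
    have "((\<lambda>t. t *\<^sub>R e) has_vector_derivative e) (at t)" by (auto intro!: derivative_eq_intros)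
    moreover have "(h has_derivative frechet_derivative h (at (t *\<^sub>R e))) (at (t *\<^sub>R e) within range (\<lambda>t. t *\<^sub>R e))"
      using smooth_on_differentiable [OF that] frechet_derivative_works has_derivative_at_withinI by blast
    ultimately show ?thesis
      using vector_derivative_diff_chain_within [of "\<lambda>t. t *\<^sub>R e" e t UNIV h]
      by (simp add: o_def has_real_derivative_iff_has_vector_derivative)
  qed
  obtain a b where affine: "\<And>t. \<Phi> (t *\<^sub>R e) = a + b * t"
  proof -
    define b where "b = dirderiv e \<Phi> 0"
    have "((\<lambda>t. dirderiv e \<Phi> (t *\<^sub>R e)) has_real_derivative 0) (at t)" for t
      using along [OF smooth_on_dirderiv [OF \<Phi>_smooth], of e t] by (simp only: \<Phi>'')
    then have "dirderiv e \<Phi> (t *\<^sub>R e) = b" for t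
      using DERIV_isconst_all [of "\<lambda>t. dirderiv e \<Phi> (t *\<^sub>R e)" t 0] by (simp add: b_def)
    then have "((\<lambda>t. \<Phi> (t *\<^sub>R e) - b * t) has_real_derivative 0) (at t)" for t
      using along [OF \<Phi>_smooth, of t] by (auto intro!: derivative_eq_intros)
    then have "\<Phi> (t *\<^sub>R e) - b * t = \<Phi> (0 *\<^sub>R e) - b * 0" for t
      using DERIV_isconst_all [of "\<lambda>t. \<Phi> (t *\<^sub>R e) - b * t" t 0] by blast
    then show ?thesis by (intro that [of "\<Phi> 0" b]) (simp add: algebra_simps)
  qed
  \<comment> \<open>On \<open>Re w = 0\<close> the function A is periodic, so its minimum over a compact set of representatives is global.\<close>
  obtain \<epsilon> where \<epsilon>: "0 < \<epsilon>" "\<And>y. Re (w_of y) = 0 \<Longrightarrow> \<epsilon> \<le> A y"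
  proof -
    obtain K where K: "compact K" "\<And>s. s \<in> span (set bs) \<Longrightarrow> \<exists>x\<in>K. \<exists>l\<in>flat_periods P \<tau>. s = x + l"
      using compact_fundamental_domain [OF flat_periods_closed bs] by blast
    have "K \<noteq> {}" using K(2) [of 0] span_zero by blast
    then obtain x0 where x0: "x0 \<in> K" "\<And>x. x \<in> K \<Longrightarrow> A x0 \<le> A x"
      using continuous_attains_inf [OF K(1), of A] continuous_on_subset [OF smooth_on_continuous [OF A_smooth]]
      by blast
    have "A x0 \<le> A y" if y: "Re (w_of y) = 0" for y
    proof -
      obtain x l where "x \<in> K" "l \<in> flat_periods P \<tau>" "y = x + l" using K(2) [of y] y span_bs by auto
      then show ?thesis using x0(2) [of x] F_per by (simp add: A_def)
    qed
    then show ?thesis using that A_pos by blast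
  qed
  have growth: "\<epsilon> * c ^ m \<le> A y" if "Re (w_of y) = real m" for m y
    using that
  proof (induction m arbitrary: y)
    case 0
    then show ?case using \<epsilon>(2) by simp
  next
    case (Suc m)
    \<comment> \<open>The preimage of \<open>y\<close> under \<open>\<gamma>\<close>.\<close>
    define y' where "y' = wz (w_of y - 1) (nak_rho lam (- 1) *v z_of y)"
    have "y = \<gamma> + ?lin \<gamma> y'"
      unfolding mult_affine [symmetric]
      by (simp add: y'_def \<gamma>_def wz_eq_iff vec_eq_iff nak_rho_nth flip: mult.assoc exp_add)
    then have "A y = c * A y'" using A_\<gamma> by simp
    moreover have "\<epsilon> * c ^ m \<le> A y'" using Suc by (intro Suc.IH) (simp add: y'_def)
    moreover have "0 < c" by (simp add: c_def)
    ultimately show ?case by (simp add: mult.left_commute)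
  qed
  have "\<epsilon> * c ^ m \<le> a + b * real m" for m
  proof -
    have "\<epsilon> * c ^ m \<le> \<Phi> (real m *\<^sub>R e)"
      unfolding \<Phi>_def
    proof (rule torus_avg_lower_bound [OF smooth_on_continuous [OF A_smooth]])
      fix s assume "s \<in> span (set bs)"
      then show "\<epsilon> * c ^ m \<le> A (real m *\<^sub>R e + s)"
        unfolding span_bs by (intro growth) (simp add: w_of_def e_def axis_def)
    qed
    then show ?thesis using affine by simp
  qed
  moreover have "1 < c" using i0 by (simp add: c_def)
  ultimately show False using affine_not_exponential [of c \<epsilon> a b] \<epsilon>(1) by (meson not_less)
qed

end
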